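(* Let $p\ge1$, let $V\in L^p(\mathbb R)^{2\times2}\cap L^\infty(\mathbb R)^{2\times2}$ and $H=H_0+V$. Then $\lambda\in\mathbb C\setminus\sigma_e(H)$ is not an eigenvalue of $H$ if $$\|V\|_1<\Gamma(M(\lambda))\,\gamma_+(\lambda)\,\gamma_-(\lambda)\qquad(\text{if }p=1),$$ $$\|V\|_p<\Gamma(M(\lambda))\,\gamma_+(\lambda)\,\gamma_-(\lambda)\,(\operatorname{Im}k(\lambda))^{\frac{p-1}p}\left(\frac p{2(p-1)}\right)^{\frac{p-1}p}\qquad(\text{if }p>1),$$ where $$\gamma_\pm(\lambda)=\frac{|\varphi_\pm(0,\lambda)|}{\sup_{x\in[0,a]}|\varphi_\pm(x,\lambda)|}.$$
   Context: Setting: $m\ge0$, $a>0$, and $q:\mathbb R\to\mathbb R$ is locally integrable and $a$-periodic. Pauli matrices: $\sigma_2=\begin{pmatrix}0&-i\\i&0\end{pmatrix}$, $\sigma_3=\begin{pmatrix}1&0\\0&-1\end{pmatrix}$; $\mathbb I$ is the $2\times2$ unit matrix; $|w|=\sqrt{|w_1|^2+|w_2|^2}$ for $w\in\mathbb C^2$. $H_0=-i\sigma_2\frac d{dx}+m\sigma_3+q$ is the self-adjoint operator in $L^2(\mathbb R)^2$ (on its maximal domain). $V:\mathbb R\to\mathbb C^{2\times2}$ is a (not necessarily Hermitian) measurable matrix-valued function, identified with the multiplication operator in $L^2(\mathbb R)^2$; $\|V\|_p=\left(\int_{\mathbb R}\|V(x)\|^p\,dx\right)^{1/p}$, with $\|V(x)\|$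 the operator norm of the matrix $V(x)$. For $\lambda\in\mathbb C$, $\Phi(\cdot,\lambda)$ is the $2\times2$ matrix solution of $-i\sigma_2\Phi'+(m\sigma_3+q)\Phi=\lambda\Phi$ on $\mathbb R$, $\Phi(0,\lambda)=\mathbb I$. The monodromy matrix is $M(\lambda)=\Phi(a,\lambda)$ (of determinant 1), the discriminant is $\mathfrak D(\lambda)=\operatorname{Tr}M(\lambda)$. The essential spectrum is $\sigma_e(H)=\sigma_e(H_0)=\{\lambda\in\mathbb R\mid\mathfrak D(\lambda)\in[-2,2]\}=\{\lambda\in\mathbb C\mid\mathfrak D(\lambda)\in[-2,2]\}$. Quasimomentum: on $\{\operatorname{Im}\lambda\ge0\}$, $k$ is a continuous function with $\mathfrak D(\lambda)=2\cos(k(\lambda)a)$ and $\operatorname{Im}k(\lambda)\ge0$; for $\operatorname{Im}\lambda<0$, $k(\lambda):=-\overline{k(\overline\lambda)}$. If $\mathfrak D(\lambda)\notin[-2,2]$, the eigenvalues of $M(\lambda)$ are $\rho(\lambda)=e^{-ik(\lambda)a}$ (outside the unit circle) and $1/\rho(\lambda)=e^{ik(\lambda)a}$ (inside the unit circle); $v_+(\lambda),v_-(\lambda)\in\mathbb C^2\setminus\{0\}$ denote corresponding eigenvectors, respectively. The functions $\varphi_\pm(x,\lambda)=e^{\pm ik(\lambda)x}\,\Phi(x,\lambda)v_\pm(\lambda)$ are $a$-periodic in $x$. For a matrix $A\in\mathbb C^{2\times2}$ with two distinct eigenvalues, $\Gamma(A)=\dfrac{|\det(w_+,w_-)|}{|w_+|\,|w_-|}\in(0,1]$,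 where $w_\pm\in\mathbb C^2\setminus\{0\}$ are eigenvectors of $A$ for the two different eigenvalues (independent of the choice of eigenvectors). *)

theory Defs
  imports "HOL-Analysis.Analysis"
begin

definition sigma2 :: "complex^2^2" where
  "sigma2 = vector [vector [0, -\<i>], vector [\<i>, 0]]"

definition sigma3 :: "complex^2^2" where
  "sigma3 = vector [vector [1, 0], vector [0, -1]]"

(* The library norm on matrices is the Frobenius norm, not the operator norm. The library onorm
   regards the matrix as a real-linear map; the supremum is the same as for the complex-linear map. *)
definition opnorm :: "complex^2^2 \<Rightarrow> real" where
  "opnorm A = onorm ((*v) A)"

definition Lp_norm :: "real \<Rightarrow> (real \<Rightarrow> complex^2^2) \<Rightarrow> real" where
  "Lp_norm p V = (LINT x|lebesgue. opnorm (V x) powr p) powr (1 / p)"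

definition in_Lp :: "real \<Rightarrow> (real \<Rightarrow> complex^2^2) \<Rightarrow> bool" where
  "in_Lp p V \<longleftrightarrow> V \<in> borel_measurable lebesgue \<and> integrable lebesgue (\<lambda>x. opnorm (V x) powr p)"

definition in_Linf :: "(real \<Rightarrow> complex^2^2) \<Rightarrow> bool" where
  "in_Linf V \<longleftrightarrow> V \<in> borel_measurable lebesgue \<and> (\<exists>C. AE x in lebesgue. opnorm (V x) \<le> C)"

definition locally_integrable :: "(real \<Rightarrow> real) \<Rightarrow> bool" where
  "locally_integrable q \<longleftrightarrow> (\<forall>c d. q absolutely_integrable_on {c..d})"

(* Absolute continuity on every compact interval; a division is a finite family of
   non-overlapping compact intervals. *)
definition loc_abs_continuous :: "(real \<Rightarrow> 'a::real_normed_vector) \<Rightarrow> bool" where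
  "loc_abs_continuous f \<longleftrightarrow>
     (\<forall>c d. \<forall>\<epsilon>>0. \<exists>\<delta>>0. \<forall>D T. D division_of T \<and> T \<subseteq> {c..d} \<and> (\<Sum>K\<in>D. measure lborel K) < \<delta> \<longrightarrow>
        (\<Sum>K\<in>D. norm (f (Sup K) - f (Inf K))) < \<epsilon>)"

(* Solutions are understood in the Caratheodory sense, since q is only locally integrable. *)
definition fundamental_matrix ::
    "real \<Rightarrow> (real \<Rightarrow> real) \<Rightarrow> complex \<Rightarrow> (real \<Rightarrow> complex^2^2) \<Rightarrow> bool" where
  "fundamental_matrix m q \<zeta> \<Phi> \<longleftrightarrow>
     loc_abs_continuous \<Phi> \<and> \<Phi> 0 = mat 1 \<and>
     (AE x in lebesgue. \<exists>\<Phi>'. (\<Phi> has_vector_derivative \<Phi>') (at x) \<and>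
        mat (-\<i>) ** sigma2 ** \<Phi>' + (mat (of_real m) ** sigma3 + mat (of_real (q x))) ** \<Phi> x
          = mat \<zeta> ** \<Phi> x)"

text \<open>Elements of $L^2(\mathbb{R})^2$ are represented by functions, and operators in this space by
  their graphs, which are invariant under changes on null sets.\<close>

definition in_L2 :: "(real \<Rightarrow> complex^2) \<Rightarrow> bool" where
  "in_L2 f \<longleftrightarrow> f \<in> borel_measurable lebesgue \<and> integrable lebesgue (\<lambda>x. (norm (f x))\<^sup>2)"

definition L2_nrm :: "(real \<Rightarrow> complex^2) \<Rightarrow> real" where
  "L2_nrm f = sqrt (LINT x|lebesgue. (norm (f x))\<^sup>2)"

type_synonym L2_operator = "(real \<Rightarrow> complex^2) \<Rightarrow> (real \<Rightarrow> complex^2) \<Rightarrow> bool"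

(* Maximal domain: the classes in L2 with a locally absolutely continuous representative u for which
   the differential expression is again in L2. The a.e. existence of the derivative is automatic. *)
definition dirac_H0 :: "real \<Rightarrow> (real \<Rightarrow> real) \<Rightarrow> L2_operator" where
  "dirac_H0 m q f g \<longleftrightarrow> in_L2 f \<and> in_L2 g \<and>
     (\<exists>u. (AE x in lebesgue. u x = f x) \<and> loc_abs_continuous u \<and>
        (AE x in lebesgue. \<exists>u'. (u has_vector_derivative u') (at x) \<and>
           g x = (-\<i>) *s (sigma2 *v u') + (mat (of_real m) ** sigma3 + mat (of_real (q x))) *v u x))"

definition dirac_H ::
    "real \<Rightarrow> (real \<Rightarrow> real) \<Rightarrow> (real \<Rightarrow> complex^2^2) \<Rightarrow> L2_operator" where
  "dirac_H m q V f g \<longleftrightarrow> in_L2 g \<and> in_L2 (\<lambda>x. V x *v f x) \<and>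
     (\<exists>h. dirac_H0 m q f h \<and> (AE x in lebesgue. g x = h x + V x *v f x))"

definition is_eigenvalue :: "L2_operator \<Rightarrow> complex \<Rightarrow> bool" where
  "is_eigenvalue T \<zeta> \<longleftrightarrow>
     (\<exists>f. in_L2 f \<and> \<not> (AE x in lebesgue. f x = 0) \<and> T f (\<lambda>x. \<zeta> *s f x))"

(* Weyl's definition by singular sequences. The inner product is the real part of the Hermitian
   one; testing with \<i> h as well as h shows that this is the usual weak convergence to 0. *)
definition essential_spectrum :: "L2_operator \<Rightarrow> complex set" where
  "essential_spectrum T = {\<zeta>. \<exists>f g.
     (\<forall>n::nat. T (f n) (g n) \<and> L2_nrm (f n) = 1) \<and>
     (\<forall>h. in_L2 h \<longrightarrow> (\<lambda>n. LINT x|lebesgue. f n x \<bullet> h x) \<longlonglongrightarrow> 0) \<and>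
     (\<lambda>n. L2_nrm (\<lambda>x. g n x - \<zeta> *s f n x)) \<longlonglongrightarrow> 0}"

definition is_quasimomentum :: "real \<Rightarrow> (complex \<Rightarrow> complex) \<Rightarrow> (complex \<Rightarrow> complex) \<Rightarrow> bool" where
  "is_quasimomentum a \<DD> k \<longleftrightarrow>
     continuous_on {\<mu>. 0 \<le> Im \<mu>} k \<and>
     (\<forall>\<mu>. 0 \<le> Im \<mu> \<longrightarrow> \<DD> \<mu> = 2 * cos (k \<mu> * of_real a) \<and> 0 \<le> Im (k \<mu>)) \<and>
     (\<forall>\<mu>. Im \<mu> < 0 \<longrightarrow> k \<mu> = - cnj (k (cnj \<mu>)))"

definition is_eigenvector :: "complex^2^2 \<Rightarrow> complex \<Rightarrow> complex^2 \<Rightarrow> bool" where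
  "is_eigenvector A e w \<longleftrightarrow> w \<noteq> 0 \<and> A *v w = e *s w"

(* Meaningful only if A has two distinct eigenvalues; the quotient is then independent of the choice
   of eigenvectors and symmetric in them. *)
definition Gamma_mat :: "complex^2^2 \<Rightarrow> real" where
  "Gamma_mat A = (THE r. \<exists>e1 e2 w1 w2. e1 \<noteq> e2 \<and> is_eigenvector A e1 w1 \<and> is_eigenvector A e2 w2 \<and>
     r = cmod (det (transpose (vector [w1, w2]) :: complex^2^2)) / (norm w1 * norm w2))"

definition floquet_plus ::
    "(real \<Rightarrow> complex^2^2) \<Rightarrow> complex \<Rightarrow> complex^2 \<Rightarrow> real \<Rightarrow> complex^2" where
  "floquet_plus \<Phi> \<kappa> v x = exp (\<i> * \<kappa> * of_real x) *s (\<Phi> x *v v)"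

definition floquet_minus ::
    "(real \<Rightarrow> complex^2^2) \<Rightarrow> complex \<Rightarrow> complex^2 \<Rightarrow> real \<Rightarrow> complex^2" where
  "floquet_minus \<Phi> \<kappa> v x = exp (- \<i> * \<kappa> * of_real x) *s (\<Phi> x *v v)"

definition gamma_ratio :: "real \<Rightarrow> (real \<Rightarrow> complex^2) \<Rightarrow> real" where
  "gamma_ratio a \<phi> = norm (\<phi> 0) / (SUP x\<in>{0..a}. norm (\<phi> x))"

end

theory Submission imports Defs begin

text \<open>
  If $u$ is an eigenfunction and $\psi_\pm = \Phi v_\pm$ are the Floquet solutions, then
  $\det(\psi_\pm, u)$ is locally absolutely continuous with derivative
  $\psi_\pm^{T} V u$. Since $\psi_+$ decays at $-\infty$ and $\psi_-$ at $+\infty$,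
  both determinants are integrals over half lines, and Cramer's rule gives
  $|u(x)| \le C \int e^{-\kappa |x-t|}\, \|V(t)\|\, |u(t)|\, dt$ with
  $\kappa = \mathrm{Im}\, k(\zeta)$ and $1/C = \Gamma\, \gamma_+ \gamma_-$. By Hoelder's inequality the
  hypothesis makes the right-hand side smaller than $\sup |u|$, so $u = 0$.

  This needs $\kappa > 0$. If $\kappa = 0$, the bound for $p > 1$ is void, and for $p = 1$ a Floquet
  solution is bounded from above and below, so cutting it off by wide tent functions yields a singular
  sequence and $\zeta$ lies in the essential spectrum.
\<close>

section \<open>Absolutely continuous functions\<close>

text \<open>As q is only locally integrable, solutions are differentiable only almost everywhere.
  But the matrix m sigma_3 + q - \<zeta> is symmetric, so it drops out of the derivative of the
  bilinear determinant, for non-real \<zeta> too, and only V u is left to integrate. Two obstacles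
  shape the estimate. A square integrable u has no pointwise limit at infinity; the boundary term is
  instead small somewhere on each half line, because the half line has infinite measure. And
  cancelling sup |u| presupposes that it is finite; this is obtained beforehand from V u in L2,
  since the exponential kernel has the same finite L2 norm for every x. For \<kappa> = 0, the
  essential spectrum is given by singular sequences of H and not by the discriminant, so a sequence
  is built for H itself; V being both integrable and essentially bounded makes its contribution
  vanish. The constant for p > 1 is the L^r norm of exp(-\<kappa>|t|) with r = p/(p-1), namely
  (2/(\<kappa> r))^(1/r), whose reciprocal is the product of the two powers in the
  hypothesis.\<close>

lemma loc_abs_continuousE:
  assumes "loc_abs_continuous f" "0 < (\<epsilon>::real)"
  obtains \<delta> where "0 < \<delta>"
    "\<And>D T. D division_of T \<Longrightarrow> T \<subseteq> {c..d} \<Longrightarrow> (\<Sum>K\<in>D. measure lborel K) < \<delta> \<Longrightarrow>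
       (\<Sum>K\<in>D. norm (f (Sup K) - f (Inf K))) < \<epsilon>"
  using assms unfolding loc_abs_continuous_def by meson

text \<open>A division made of one short interval turns the definition into ordinary
  continuity.\<close>

lemma loc_abs_continuous_imp_continuous_on:
  fixes f :: "real \<Rightarrow> 'a::real_normed_vector"
  assumes "loc_abs_continuous f"
  shows "continuous_on S f"
proof -
  have "\<exists>\<delta>>0. \<forall>y. dist y x < \<delta> \<longrightarrow> dist (f y) (f x) < \<epsilon>" if "0 < \<epsilon>" for x \<epsilon>
  proof -
    obtain \<delta> where \<delta>: "0 < \<delta>"
      "\<And>D T. D division_of T \<Longrightarrow> T \<subseteq> {x-1..x+1} \<Longrightarrow> (\<Sum>K\<in>D. measure lborel K) < \<delta> \<Longrightarrow>
        (\<Sum>K\<in>D. norm (f (Sup K) - f (Inf K))) < \<epsilon>"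
      using loc_abs_continuousE[OF assms \<open>0 < \<epsilon>\<close>] by metis
    have small: "norm (f t - f s) < \<epsilon>" if "s \<le> t" "{s..t} \<subseteq> {x-1..x+1}" "t - s < \<delta>" for s t
    proof -
      have "{{s..t}} division_of {s..t}"
        using \<open>s \<le> t\<close> division_of_self[of s t] by simp
      from \<delta>(2)[OF this] that show ?thesis by simp
    qed
    have "dist (f y) (f x) < \<epsilon>" if "dist y x < min \<delta> 1" for y
      using that small[of x y] small[of y x]
      by (cases "x \<le> y") (auto simp: dist_norm norm_minus_commute abs_if split: if_splits)
    then show ?thesis
      using \<delta>(1) by (intro exI[of _ "min \<delta> 1"]) auto
  qed
  then show ?thesis
    by (intro continuous_at_imp_continuous_on) (auto simp: continuous_at_eps_delta)
qed

text \<open>The common reason why Lipschitz functions, linear images and bilinear products are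
  absolutely continuous. \<open>B\<close> may depend on the interval because a product needs a bound
  of its factors there.\<close>

lemma loc_abs_continuous_dominated:
  fixes F :: "real \<Rightarrow> 'c::real_normed_vector"
  assumes f: "loc_abs_continuous f" and g: "loc_abs_continuous g"
    and bound: "\<And>c d. \<exists>B\<ge>0. \<forall>s\<in>{c..d}. \<forall>t\<in>{c..d}.
      norm (F t - F s) \<le> B * (norm (f t - f s) + norm (g t - g s))"
  shows "loc_abs_continuous F"
  unfolding loc_abs_continuous_def
proof (intro allI impI)
  fix c d \<epsilon> :: real assume "0 < \<epsilon>"
  obtain B where B: "B \<ge> 0" "\<And>s t. s \<in> {c..d} \<Longrightarrow> t \<in> {c..d} \<Longrightarrow>
      norm (F t - F s) \<le> B * (norm (f t - f s) + norm (g t - g s))"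
    using bound by meson
  \<comment> \<open>The added 1 covers \<open>B = 0\<close>.\<close>
  define e where "e = \<epsilon> / (2 * (B + 1))"
  have "B * (e + e) = B * \<epsilon> / (B + 1)" using B(1) by (simp add: e_def divide_simps)
  also have "\<dots> < \<epsilon>" using \<open>0 < \<epsilon>\<close> B(1) by (simp add: pos_divide_less_eq algebra_simps)
  finally have e: "0 < e" "B * (e + e) < \<epsilon>" using \<open>0 < \<epsilon>\<close> B(1) by (auto simp: e_def)
  obtain d1 where d1: "0 < d1" "\<And>D T. D division_of T \<Longrightarrow> T \<subseteq> {c..d} \<Longrightarrow> (\<Sum>K\<in>D. measure lborel K) < d1 \<Longrightarrow>
       (\<Sum>K\<in>D. norm (f (Sup K) - f (Inf K))) < e"
    using loc_abs_continuousE[OF f e(1)] by metis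
  obtain d2 where d2: "0 < d2" "\<And>D T. D division_of T \<Longrightarrow> T \<subseteq> {c..d} \<Longrightarrow> (\<Sum>K\<in>D. measure lborel K) < d2 \<Longrightarrow>
       (\<Sum>K\<in>D. norm (g (Sup K) - g (Inf K))) < e"
    using loc_abs_continuousE[OF g e(1)] by metis
  have "(\<Sum>K\<in>D. norm (F (Sup K) - F (Inf K))) < \<epsilon>"
    if D: "D division_of T" "T \<subseteq> {c..d}" "(\<Sum>K\<in>D. measure lborel K) < min d1 d2" for D T
  proof -
    have "(\<Sum>K\<in>D. norm (F (Sup K) - F (Inf K)))
        \<le> (\<Sum>K\<in>D. B * (norm (f (Sup K) - f (Inf K)) + norm (g (Sup K) - g (Inf K))))"
    proof (rule sum_mono)
      fix K assume K: "K \<in> D"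
      obtain u v where uv: "K = {u..v}" "u \<le> v"
        using division_ofD(3,4)[OF D(1) K] by (metis atLeastatMost_empty_iff box_real(2))
      have "K \<subseteq> {c..d}" using division_ofD(2)[OF D(1) K] D(2) by blast
      then have "u \<in> {c..d}" "v \<in> {c..d}" using uv by auto
      then show "norm (F (Sup K) - F (Inf K)) \<le> B * (norm (f (Sup K) - f (Inf K)) + norm (g (Sup K) - g (Inf K)))"
        using B(2) uv by simp
    qed
    also have "\<dots> = B * ((\<Sum>K\<in>D. norm (f (Sup K) - f (Inf K))) + (\<Sum>K\<in>D. norm (g (Sup K) - g (Inf K))))"
      by (simp add: sum.distrib flip: sum_distrib_left)
    also have "\<dots> \<le> B * (e + e)"
      using D d1(2)[OF D(1,2)] d2(2)[OF D(1,2)] B(1) by (intro mult_left_mono add_mono) auto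
    finally show ?thesis using e(2) by linarith
  qed
  then show "\<exists>\<delta>>0. \<forall>D T. D division_of T \<and> T \<subseteq> {c..d} \<and> (\<Sum>K\<in>D. measure lborel K) < \<delta> \<longrightarrow>
        (\<Sum>K\<in>D. norm (F (Sup K) - F (Inf K))) < \<epsilon>"
    using d1(1) d2(1) by (intro exI[of _ "min d1 d2"]) auto
qed

lemma loc_abs_continuous_id: "loc_abs_continuous (\<lambda>x::real. x)"
  unfolding loc_abs_continuous_def
proof (intro allI impI)
  fix c d \<epsilon> :: real assume "0 < \<epsilon>"
  have "(\<Sum>K\<in>D. norm (Sup K - Inf K)) = (\<Sum>K\<in>D. measure lborel K)" if D: "D division_of T" for D and T :: "real set"
  proof (rule sum.cong[OF refl])
    fix K assume K: "K \<in> D"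
    obtain u v where uv: "K = {u..v}" "u \<le> v"
      using division_ofD(3,4)[OF D K] by (metis atLeastatMost_empty_iff box_real(2))
    then show "norm (Sup K - Inf K) = measure lborel K" by simp
  qed
  then show "\<exists>\<delta>>0. \<forall>D T. D division_of T \<and> T \<subseteq> {c..d} \<and> (\<Sum>K\<in>D. measure lborel K) < \<delta> \<longrightarrow>
        (\<Sum>K\<in>D. norm (Sup K - Inf K)) < \<epsilon>"
    using \<open>0 < \<epsilon>\<close> by (metis (no_types, lifting))
qed

lemma loc_abs_continuous_lipschitz:
  assumes "\<And>s t. norm (f t - f s) \<le> L * \<bar>t - s\<bar>" "0 \<le> L"
  shows "loc_abs_continuous f"
proof (rule loc_abs_continuous_dominated[OF loc_abs_continuous_id loc_abs_continuous_id])
  have "norm (f t - f s) \<le> L * (norm (t - s) + norm (t - s))" for s t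
  proof -
    have "norm (f t - f s) \<le> L * norm (t - s)" using assms(1)[of t s] by simp
    also have "\<dots> \<le> L * (norm (t - s) + norm (t - s))"
      using assms(2) by (intro mult_left_mono) auto
    finally show ?thesis .
  qed
  then show "\<exists>B\<ge>0. \<forall>s\<in>{c..d}. \<forall>t\<in>{c..d}. norm (f t - f s) \<le> B * (norm (t - s) + norm (t - s))" for c d
    using assms(2) by auto
qed

lemma loc_abs_continuous_bounded_linear:
  assumes T: "bounded_linear T" and f: "loc_abs_continuous f"
  shows "loc_abs_continuous (\<lambda>x. T (f x))"
proof (rule loc_abs_continuous_dominated[OF f f])
  obtain K where K: "0 < K" "\<And>x. norm (T x) \<le> norm x * K"
    using bounded_linear.pos_bounded[OF T] by auto
  have "norm (T (f t) - T (f s)) \<le> K * (norm (f t - f s) + norm (f t - f s))" for s t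
  proof -
    have "norm (T (f t) - T (f s)) \<le> K * norm (f t - f s)"
      using K(2)[of "f t - f s"] linear_diff[OF bounded_linear.linear[OF T]] by (simp add: mult.commute)
    also have "\<dots> \<le> K * (norm (f t - f s) + norm (f t - f s))"
      using K(1) by (intro mult_left_mono) auto
    finally show ?thesis .
  qed
  then show "\<exists>B\<ge>0. \<forall>s\<in>{c..d}. \<forall>t\<in>{c..d}. norm (T (f t) - T (f s)) \<le> B * (norm (f t - f s) + norm (f t - f s))" for c d
    using K(1) by (intro exI[of _ K]) auto
qed

lemma loc_abs_continuous_bounded_bilinear:
  assumes T: "bounded_bilinear T" and f: "loc_abs_continuous f" and g: "loc_abs_continuous g"
  shows "loc_abs_continuous (\<lambda>x. T (f x) (g x))"
proof (rule loc_abs_continuous_dominated[OF f g])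
  fix c d :: real
  interpret bounded_bilinear T by fact
  obtain K where K: "0 < K" "\<And>x y. norm (T x y) \<le> norm x * norm y * K"
    using pos_bounded by auto
  have "bounded (f ` {c..d})" "bounded (g ` {c..d})"
    using f g by (auto intro!: compact_imp_bounded compact_continuous_image loc_abs_continuous_imp_continuous_on)
  then obtain F G where F: "\<forall>s\<in>{c..d}. norm (f s) \<le> F" and G: "\<forall>s\<in>{c..d}. norm (g s) \<le> G"
    unfolding bounded_iff by auto
  define M where "M = max 0 (max F G)"
  have M: "0 \<le> M" "\<And>s. s \<in> {c..d} \<Longrightarrow> norm (f s) \<le> M" "\<And>s. s \<in> {c..d} \<Longrightarrow> norm (g s) \<le> M"
    using F G by (auto simp: M_def le_max_iff_disj)
  have "norm (T (f t) (g t) - T (f s) (g s)) \<le> M * K * (norm (f t - f s) + norm (g t - g s))"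
    if st: "s \<in> {c..d}" "t \<in> {c..d}" for s t
  proof -
    have "T (f t) (g t) - T (f s) (g s) = T (f t - f s) (g t) + T (f s) (g t - g s)"
      by (simp add: diff_left diff_right)
    also have "norm \<dots> \<le> norm (f t - f s) * norm (g t) * K + norm (f s) * norm (g t - g s) * K"
      by (intro norm_triangle_le add_mono K)
    also have "\<dots> \<le> norm (f t - f s) * M * K + M * norm (g t - g s) * K"
      using K(1) M st by (intro add_mono mult_right_mono mult_left_mono) auto
    finally show ?thesis by (simp add: algebra_simps)
  qed
  then show "\<exists>B\<ge>0. \<forall>s\<in>{c..d}. \<forall>t\<in>{c..d}. norm (T (f t) (g t) - T (f s) (g s)) \<le> B * (norm (f t - f s) + norm (g t - g s))"
    using K(1) M(1) by (intro exI[of _ "M * K"]) auto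
qed

text \<open>For the shift of a solution by one period: moving every interval of a division by
  \<open>a\<close> gives a division with the same lengths.\<close>

lemma loc_abs_continuous_translate:
  fixes f :: "real \<Rightarrow> 'a::real_normed_vector"
  assumes f: "loc_abs_continuous f"
  shows "loc_abs_continuous (\<lambda>x. f (x + a))"
  unfolding loc_abs_continuous_def
proof (intro allI impI)
  fix c d \<epsilon> :: real assume "0 < \<epsilon>"
  obtain \<delta> where \<delta>: "0 < \<delta>" "\<And>D T. D division_of T \<Longrightarrow> T \<subseteq> {c+a..d+a} \<Longrightarrow> (\<Sum>K\<in>D. measure lborel K) < \<delta> \<Longrightarrow>
       (\<Sum>K\<in>D. norm (f (Sup K) - f (Inf K))) < \<epsilon>"
    using loc_abs_continuousE[OF f \<open>0 < \<epsilon>\<close>] by metis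
  have "(\<Sum>K\<in>D. norm (f (Sup K + a) - f (Inf K + a))) < \<epsilon>"
    if D: "D division_of T" "T \<subseteq> {c..d}" "(\<Sum>K\<in>D. measure lborel K) < \<delta>" for D T
  proof -
    let ?t = "(`) ((+) a)"
    have inj: "inj_on ?t D"
      by (rule inj_onI) (simp add: inj_image_eq_iff)
    have form: "\<exists>u v. K = {u..v} \<and> u \<le> v" if "K \<in> D" for K
      using division_ofD(3,4)[OF D(1) that] by (metis atLeastatMost_empty_iff box_real(2))
    have "?t ` D division_of ?t T"
    proof (rule division_ofI)
      show "finite (?t ` D)" using division_ofD(1)[OF D(1)] by simp
      show "K \<subseteq> ?t T" if "K \<in> ?t ` D" for K
        using that division_ofD(2)[OF D(1)] by blast
      show "K \<noteq> {}" if "K \<in> ?t ` D" for K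
        using that division_ofD(3)[OF D(1)] by blast
      show "\<exists>u v. K = cbox u v" if "K \<in> ?t ` D" for K
      proof -
        obtain K' u v where "K = ?t K'" "K' = {u..v}"
          using \<open>K \<in> ?t ` D\<close> form by blast
        then have "K = cbox (a + u) (a + v)" by simp
        then show ?thesis by blast
      qed
      show "interior K \<inter> interior L = {}" if "K \<in> ?t ` D" "L \<in> ?t ` D" "K \<noteq> L" for K L
      proof -
        obtain K' L' where "K = ?t K'" "L = ?t L'" "K' \<in> D" "L' \<in> D" "K' \<noteq> L'"
          using \<open>K \<in> ?t ` D\<close> \<open>L \<in> ?t ` D\<close> \<open>K \<noteq> L\<close> by blast
        then show ?thesis
          using division_ofD(5)[OF D(1), of K' L'] by (auto simp: interior_translation)
      qed
      show "\<Union> (?t ` D) = ?t T"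
        using division_ofD(6)[OF D(1)] by blast
    qed
    moreover have "?t T \<subseteq> {c+a..d+a}" using D(2) by auto
    moreover have "(\<Sum>K\<in>?t ` D. measure lborel K) = (\<Sum>K\<in>D. measure lborel K)"
      unfolding sum.reindex[OF inj] o_def
    proof (rule sum.cong[OF refl])
      fix K assume "K \<in> D"
      then obtain u v where "K = {u..v}" "u \<le> v" using form by blast
      then show "measure lborel (?t K) = measure lborel K" by simp
    qed
    ultimately have "(\<Sum>K\<in>?t ` D. norm (f (Sup K) - f (Inf K))) < \<epsilon>"
      using \<delta>(2) D(3) by metis
    also have "(\<Sum>K\<in>?t ` D. norm (f (Sup K) - f (Inf K))) = (\<Sum>K\<in>D. norm (f (Sup K + a) - f (Inf K + a)))"
      unfolding sum.reindex[OF inj] o_def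
    proof (rule sum.cong[OF refl])
      fix K assume "K \<in> D"
      then obtain u v where "K = {u..v}" "u \<le> v" using form by blast
      then show "norm (f (Sup (?t K)) - f (Inf (?t K))) = norm (f (Sup K + a) - f (Inf K + a))"
        by (simp add: add.commute)
    qed
    finally show ?thesis .
  qed
  then show "\<exists>\<delta>>0. \<forall>D T. D division_of T \<and> T \<subseteq> {c..d} \<and> (\<Sum>K\<in>D. measure lborel K) < \<delta> \<longrightarrow>
        (\<Sum>K\<in>D. norm (f (Sup K + a) - f (Inf K + a))) < \<epsilon>"
    using \<delta>(1) by (intro exI[of _ \<delta>]) auto
qed

text \<open>The gauge is an open set of small measure at the points of the exceptional null set, where the
  Riemann sum is controlled by absolute continuity, and a straddle neighbourhood elsewhere.\<close>

theorem loc_abs_continuous_has_integral: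
  fixes f :: "real \<Rightarrow> 'a::banach"
  assumes f: "loc_abs_continuous f" and "a \<le> b"
    and g: "AE x in lebesgue. (f has_vector_derivative g x) (at x)"
  shows "(g has_integral (f b - f a)) {a..b}"
proof -
  obtain N where N: "negligible N" "\<And>x. x \<notin> N \<Longrightarrow> (f has_vector_derivative g x) (at x)"
    using g unfolding eventually_ae_filter_negligible by blast
  \<comment> \<open>With the value 0 on \<open>N\<close>, an interval tagged in \<open>N\<close>
    contributes to the error just an increment of \<open>f\<close>, which absolute continuity
    controls.\<close>
  define h where "h x = (if x \<in> N then 0 else g x)" for x
  have "(h has_integral (f b - f a)) {a..b}"
    unfolding has_integral_real
  proof (intro allI impI)
    fix e0 :: real assume "0 < e0"
    \<comment> \<open>Tags outside \<open>N\<close> will cost at most \<open>e * (b - a)\<close>,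
      tags in \<open>N\<close> at most \<open>e\<close>; the added 1 allows
      \<open>a = b\<close>.\<close>
    define e where "e = e0 / (2 * (b - a + 1))"
    have "e * (b - a) + e = e * (b - a + 1)" by (simp add: algebra_simps)
    also have "\<dots> = e0 / 2"
    proof -
      have "b - a + 1 \<noteq> 0" using \<open>a \<le> b\<close> by linarith
      then show ?thesis by (simp only: e_def) (simp add: divide_simps)
    qed
    finally have "e * (b - a) + e < e0" using \<open>0 < e0\<close> by simp
    moreover have "0 < e" using \<open>0 < e0\<close> \<open>a \<le> b\<close> by (simp add: e_def)
    ultimately have e: "0 < e" "e * (b - a) + e < e0" by auto
    have "\<forall>x. \<exists>d>0. x \<notin> N \<longrightarrow> (\<forall>y. norm (y-x) < d \<longrightarrow> norm (f y - f x - (y-x) *\<^sub>R g x) \<le> e * norm (y-x))"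
    proof
      fix x
      show "\<exists>d>0. x \<notin> N \<longrightarrow> (\<forall>y. norm (y-x) < d \<longrightarrow> norm (f y - f x - (y-x) *\<^sub>R g x) \<le> e * norm (y-x))"
      proof (cases "x \<in> N")
        case False
        from N(2)[OF this] e(1) show ?thesis
          unfolding has_vector_derivative_def has_derivative_at_alt by blast
      qed (auto intro: exI[of _ 1])
    qed
    then obtain d where d: "\<And>x. 0 < d x"
      "\<And>x y. x \<notin> N \<Longrightarrow> norm (y-x) < d x \<Longrightarrow> norm (f y - f x - (y-x) *\<^sub>R g x) \<le> e * norm (y-x)"
      by metis
    obtain \<delta> where \<delta>: "0 < \<delta>" "\<And>D T. D division_of T \<Longrightarrow> T \<subseteq> {a..b} \<Longrightarrow> (\<Sum>K\<in>D. measure lborel K) < \<delta> \<Longrightarrow>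
       (\<Sum>K\<in>D. norm (f (Sup K) - f (Inf K))) < e"
      using loc_abs_continuousE[OF f e(1)] by metis
    have N0: "N \<in> null_sets lebesgue" using N(1) by (simp add: negligible_iff_null_sets)
    obtain U where U: "open U" "N \<subseteq> U" "emeasure lebesgue (U - N) < ennreal \<delta>"
      by (rule sets_lebesgue_outer_open[OF null_setsD2[OF N0] \<delta>(1)])
    have eU: "emeasure lborel U < ennreal \<delta>"
    proof -
      have "emeasure lebesgue (U - N) = emeasure lebesgue U"
        by (rule emeasure_Diff_null_set[OF N0]) (use U(1) in auto)
      with U show ?thesis by simp
    qed
    define \<gamma> where "\<gamma> x = (if x \<in> N then U else ball x (d x))" for x
    have "gauge \<gamma>"
      using U d(1) by (auto simp: gauge_def \<gamma>_def)
    moreover have "norm ((\<Sum>(x,K)\<in>p. measure lborel K *\<^sub>R h x) - (f b - f a)) < e0"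
      if p: "p tagged_division_of {a..b}" "\<gamma> fine p" for p
    proof -
      have fin: "finite p" using p(1) by blast
      have form: "\<exists>u v. K = {u..v} \<and> u \<le> v \<and> x \<in> K \<and> K \<subseteq> {a..b} \<and> K \<subseteq> \<gamma> x" if xK: "(x,K) \<in> p" for x K
      proof -
        have "x \<in> K" "K \<subseteq> {a..b}" "\<exists>u v. K = cbox u v"
          using tagged_division_ofD(2,3,4)[OF p(1) xK] by auto
        moreover have "K \<subseteq> \<gamma> x" using p(2) xK by (auto simp: fine_def)
        moreover from calculation(3) obtain u v where uv: "K = {u..v}" by auto
        moreover from calculation(1) uv have "u \<le> v" by auto
        ultimately show ?thesis by blast
      qed
      define R where "R = (\<lambda>(x,K). measure lborel K *\<^sub>R h x - (f (Sup K) - f (Inf K)))"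
      define pN where "pN = {(x,K)\<in>p. x \<in> N}"
      have ba: "b - a = (\<Sum>(x,K)\<in>p. Sup K - Inf K)" "f b - f a = (\<Sum>(x,K)\<in>p. f(Sup K) - f(Inf K))"
        using additive_tagged_division_1[where f= "\<lambda>x. x"] additive_tagged_division_1[where f= f]
            \<open>a \<le> b\<close> p(1) by auto
      have "(\<Sum>(x,K)\<in>p. measure lborel K *\<^sub>R h x) - (f b - f a) = sum R p"
        by (simp add: ba R_def split_def sum_subtractf)
      also have "\<dots> = sum R (p - pN) + sum R pN"
        using fin by (subst sum.subset_diff[of pN p]) (auto simp: pN_def)
      finally have eq: "norm ((\<Sum>(x,K)\<in>p. measure lborel K *\<^sub>R h x) - (f b - f a)) \<le> (\<Sum>i\<in>p - pN. norm (R i)) + (\<Sum>i\<in>pN. norm (R i))"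
        using norm_triangle_mono[OF norm_sum norm_sum] by metis
      have "(\<Sum>i\<in>p - pN. norm (R i)) \<le> (\<Sum>(x,K)\<in>p - pN. e * (Sup K - Inf K))"
      proof (rule sum_mono)
        fix i assume "i \<in> p - pN"
        then obtain x K where i: "i = (x,K)" "(x,K) \<in> p" "x \<notin> N" by (auto simp: pN_def)
        obtain u v where K: "K = {u..v}" "u \<le> v" "x \<in> K" "K \<subseteq> ball x (d x)"
          using form[OF i(2)] i(3) unfolding \<gamma>_def by (metis (full_types))
        have "u \<in> K" "v \<in> K" using K by auto
        then have "norm (u - x) < d x" "norm (v - x) < d x" using K(4) by (auto simp: dist_real_def)
        then have "norm (f u - f x - (u - x) *\<^sub>R g x) + norm (f v - f x - (v - x) *\<^sub>R g x) \<le> e * norm (u - x) + e * norm (v - x)"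
          using d(2)[OF i(3)] by (intro add_mono) auto
        also have "\<dots> = e * (v - u)"
        proof -
          have "norm (u - x) = x - u" "norm (v - x) = v - x" using K(1,3) by auto
          then show ?thesis by (simp add: algebra_simps)
        qed
        finally have "norm ((f u - f x - (u - x) *\<^sub>R g x) - (f v - f x - (v - x) *\<^sub>R g x)) \<le> e * (v - u)"
          by (rule order_trans[OF norm_triangle_ineq4])
        also have "(f u - f x - (u - x) *\<^sub>R g x) - (f v - f x - (v - x) *\<^sub>R g x) = (v - u) *\<^sub>R g x - (f v - f u)"
          by (auto simp: algebra_simps)
        finally show "norm (R i) \<le> (case i of (x,K) \<Rightarrow> e * (Sup K - Inf K))"
          using i K by (simp add: R_def h_def)
      qed
      also have "\<dots> \<le> (\<Sum>(x,K)\<in>p. e * (Sup K - Inf K))"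
      proof (rule sum_mono2[OF fin])
        fix i assume "i \<in> p - (p - pN)"
        then obtain x K where i: "i = (x,K)" "(x,K) \<in> p" by (cases i) auto
        obtain u v where "K = {u..v}" "u \<le> v" using form[OF i(2)] by blast
        then show "0 \<le> (case i of (x,K) \<Rightarrow> e * (Sup K - Inf K))" using i e(1) by simp
      qed auto
      also have "\<dots> = e * (b - a)"
        by (simp add: ba(1) sum_distrib_left split_def)
      finally have 1: "(\<Sum>i\<in>p - pN. norm (R i)) \<le> e * (b - a)" .
      \<comment> \<open>Absolute continuity speaks of sets of intervals, so tags must be forgotten
        injectively. Disjointness of interiors gives this for nondegenerate intervals; degenerate
        ones are dropped, since their terms \<open>R\<close> vanish.\<close>
      define p' where "p' = {(x,K)\<in>pN. measure lborel K \<noteq> 0}"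
      have p'p: "p' \<subseteq> p" by (auto simp: p'_def pN_def)
      have ptd: "p' tagged_partial_division_of {a..b}"
        using p(1) p'p unfolding tagged_division_of_def by (blast intro: tagged_partial_division_subset)
      have inj: "inj_on snd p'"
      proof (rule inj_onI, clarsimp)
        fix x K y assume xy: "(x,K) \<in> p'" "(y,K) \<in> p'"
        show "x = y"
        proof (rule ccontr)
          assume "x \<noteq> y"
          then have "interior K = {}"
            using tagged_partial_division_ofD(5)[OF ptd xy] by simp
          moreover obtain u v where "K = {u..v}" "u \<le> v" using form xy p'p by blast
          moreover have "measure lborel K \<noteq> 0" using xy by (simp add: p'_def)
          ultimately show False by simp
        qed
      qed
      have div: "snd ` p' division_of \<Union>(snd ` p')"
        by (rule partial_division_of_tagged_division[OF ptd])
      have sub: "\<Union>(snd ` p') \<subseteq> {a..b}"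
      proof
        fix t assume "t \<in> \<Union>(snd ` p')"
        then obtain x K where "(x,K) \<in> p" "t \<in> K" using p'p by auto
        then show "t \<in> {a..b}" using form by blast
      qed
      have meas: "\<Union>(snd ` p') \<in> sets lborel"
      proof (rule sets.finite_Union)
        show "finite (snd ` p')" using fin p'p by (meson finite_imageI finite_subset)
        show "snd ` p' \<subseteq> sets lborel"
        proof
          fix K assume "K \<in> snd ` p'"
          then obtain x where "(x,K) \<in> p" using p'p by auto
          then obtain u v where "K = {u..v}" using form by blast
          then show "K \<in> sets lborel" by simp
        qed
      qed
      have "(\<Sum>K\<in>snd ` p'. measure lebesgue K) = (\<Sum>K\<in>snd ` p'. measure lborel K)"
      proof (rule sum.cong[OF refl])
        fix K assume "K \<in> snd ` p'"
        then obtain x where "(x,K) \<in> p" using p'p by auto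
        then obtain u v where "K = {u..v}" using form by blast
        then show "measure lebesgue K = measure lborel K" by simp
      qed
      then have "(\<Sum>K\<in>snd ` p'. measure lborel K) = measure lborel (\<Union>(snd ` p'))"
        by (metis content_division[OF div] measure_completion[OF meas])
      \<comment> \<open>Fineness puts every interval tagged in \<open>N\<close> inside
        \<open>U\<close>, so their total length stays below \<delta>.\<close>
      also have "\<dots> \<le> measure lborel U"
      proof (rule measure_mono_fmeasurable)
        show "\<Union>(snd ` p') \<subseteq> U"
        proof
          fix t assume "t \<in> \<Union>(snd ` p')"
          then obtain x K where "(x,K) \<in> p" "x \<in> N" "t \<in> K" by (auto simp: p'_def pN_def)
          then show "t \<in> U" using form[of x K] by (auto simp: \<gamma>_def)
        qed
        show "U \<in> fmeasurable lborel"
          using U(1) less_trans[OF eU ennreal_less_top] by (simp add: fmeasurable_def)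
        show "\<Union>(snd ` p') \<in> sets lborel" by (rule meas)
      qed
      also have "\<dots> < \<delta>"      proof -
        have "emeasure lborel U \<noteq> top" using eU by (auto simp: top_unique)
        then have "emeasure lborel U = ennreal (measure lborel U)" by (rule emeasure_eq_ennreal_measure)
        then show ?thesis using eU by (simp add: ennreal_less_iff)
      qed
      finally have "(\<Sum>K\<in>snd ` p'. norm (f (Sup K) - f (Inf K))) < e"
        using \<delta>(2)[OF div sub] by simp
      moreover have "(\<Sum>K\<in>snd ` p'. norm (f (Sup K) - f (Inf K))) = (\<Sum>i\<in>pN. norm (R i))"
        unfolding sum.reindex[OF inj] o_def
      proof (rule sum.mono_neutral_cong_left)
        show "finite pN" using fin by (rule finite_subset[rotated]) (auto simp: pN_def)
        show "p' \<subseteq> pN" by (auto simp: p'_def)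
        show "\<forall>i\<in>pN - p'. norm (R i) = 0"
        proof
          fix i assume "i \<in> pN - p'"
          then obtain x K where i: "i = (x,K)" "(x,K) \<in> p" "measure lborel K = 0" by (auto simp: pN_def p'_def)
          obtain u v where "K = {u..v}" "u \<le> v" using form[OF i(2)] by blast
          with i show "norm (R i) = 0" by (simp add: R_def)
        qed
        show "norm (f (Sup (snd i)) - f (Inf (snd i))) = norm (R i)" if "i \<in> p'" for i
          using that by (auto simp: p'_def pN_def R_def h_def norm_minus_commute)
      qed
      ultimately show ?thesis using eq 1 e(2) by linarith
    qed
    ultimately show "\<exists>\<gamma>. gauge \<gamma> \<and> (\<forall>\<D>. \<D> tagged_division_of {a..b} \<and> \<gamma> fine \<D> \<longrightarrow>
        norm ((\<Sum>(x,K)\<in>\<D>. measure lborel K *\<^sub>R h x) - (f b - f a)) < e0)"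
      by (intro exI[of _ \<gamma>] conjI allI impI) simp_all
  qed
  then show ?thesis
    by (rule has_integral_spike[OF N(1), rotated]) (auto simp: h_def)
qed

section \<open>The Dirac system and its Wronskian\<close>

definition wedge :: "complex^2 \<Rightarrow> complex^2 \<Rightarrow> complex" where
  "wedge y u = y $ 1 * u $ 2 - y $ 2 * u $ 1"

text \<open>Deliberately without conjugation: the symmetric terms in m, q and \<zeta> cancel in the
  bilinear pairing even if \<zeta> is not real.\<close>

definition cdot :: "complex^2 \<Rightarrow> complex^2 \<Rightarrow> complex" where
  "cdot y u = y $ 1 * u $ 1 + y $ 2 * u $ 2"

lemma bounded_bilinear_wedge: "bounded_bilinear wedge"
  unfolding bilinear_conv_bounded_bilinear[symmetric] bilinear_def
  by (auto intro!: linearI simp: wedge_def algebra_simps)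

text \<open>Cramer's rule with the determinant kept as a factor, so that it can also be applied to
  dependent \<open>a\<close> and \<open>b\<close>.\<close>

lemma wedge_cramer: "wedge a b *s y = wedge y b *s a - wedge y a *s b"
  by (simp add: vec_eq_iff forall_2 wedge_def algebra_simps)

lemma norm_vec2: "norm (v :: complex^2) = sqrt ((norm (v $ 1))\<^sup>2 + (norm (v $ 2))\<^sup>2)"
  by (simp add: norm_vec_def L2_set_def sum_2)

lemma norm_cdot_le: "norm (cdot y u) \<le> norm y * norm u"
proof -
  have "norm (cdot y u) \<le> norm (y $ 1) * norm (u $ 1) + norm (y $ 2) * norm (u $ 2)"
    unfolding cdot_def by (metis norm_mult norm_triangle_ineq)
  also have "\<dots> \<le> sqrt ((norm (y $ 1) * norm (u $ 1) + norm (y $ 2) * norm (u $ 2))\<^sup>2)"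
    by simp
  also have "\<dots> \<le> sqrt (((norm (y $ 1))\<^sup>2 + (norm (y $ 2))\<^sup>2) * ((norm (u $ 1))\<^sup>2 + (norm (u $ 2))\<^sup>2))"
  proof (rule real_sqrt_le_mono)
    have "0 \<le> (norm (y $ 1) * norm (u $ 2) - norm (y $ 2) * norm (u $ 1))\<^sup>2" by simp
    then show "(norm (y $ 1) * norm (u $ 1) + norm (y $ 2) * norm (u $ 2))\<^sup>2
        \<le> ((norm (y $ 1))\<^sup>2 + (norm (y $ 2))\<^sup>2) * ((norm (u $ 1))\<^sup>2 + (norm (u $ 2))\<^sup>2)"
      by (simp add: power2_eq_square algebra_simps)
  qed
  also have "\<dots> = norm y * norm u"
    by (simp add: norm_vec2 real_sqrt_mult)
  finally show ?thesis .
qed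

lemma norm_smult_vec2: "norm (c *s (v :: complex^2)) = norm c * norm v"
proof -
  have "(norm (c * v $ 1))\<^sup>2 + (norm (c * v $ 2))\<^sup>2 = (norm c)\<^sup>2 * ((norm (v $ 1))\<^sup>2 + (norm (v $ 2))\<^sup>2)"
    by (simp add: norm_mult power_mult_distrib algebra_simps)
  then show ?thesis by (simp add: norm_vec2 real_sqrt_mult)
qed

text \<open>Replacing (u1, u2) by (u2, -u1) turns the determinant into a pairing, so this is again
  the Cauchy-Schwarz inequality.\<close>

lemma norm_wedge_le: "norm (wedge y u) \<le> norm y * norm u"
proof -
  have "wedge y u = cdot y (vector [u $ 2, - u $ 1])"
    by (simp add: wedge_def cdot_def)
  moreover have "norm (vector [u $ 2, - u $ 1] :: complex^2) = norm u"
    by (simp add: norm_vec2 add.commute)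
  ultimately show ?thesis using norm_cdot_le by metis
qed

lemma bounded_linear_matrix_vector_mult_left:
  "bounded_linear (\<lambda>A :: complex^2^2. A *v v)"
  unfolding linear_conv_bounded_linear[symmetric]
  by (auto intro!: linearI simp: vec_eq_iff matrix_vector_mult_def sum_2 algebra_simps)

text \<open>The equation $-i\sigma_2 y' + (m\sigma_3 + q - \zeta)\, y = r$ in components.\<close>

definition dirac_solution ::
    "real \<Rightarrow> (real \<Rightarrow> real) \<Rightarrow> complex \<Rightarrow> (real \<Rightarrow> complex^2) \<Rightarrow> (real \<Rightarrow> complex^2) \<Rightarrow> bool" where
  "dirac_solution m q \<zeta> y r \<longleftrightarrow> loc_abs_continuous y \<and>
     (AE x in lebesgue. \<exists>y'. (y has_vector_derivative y') (at x) \<and>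
        - y' $ 2 + (of_real (m + q x) - \<zeta>) * y x $ 1 = r x $ 1 \<and>
        y' $ 1 + (of_real (q x - m) - \<zeta>) * y x $ 2 = r x $ 2)"

text \<open>The matrix -i sigma_2 is real and sends (w1, w2) to (-w2, w1).\<close>

lemma dirac_expression_components:
  "((-\<i>) *s (sigma2 *v w) + (mat (of_real m) ** sigma3 + mat (of_real c)) *v z) $ 1
     = - w $ 2 + of_real (m + c) * z $ 1"
  "((-\<i>) *s (sigma2 *v w) + (mat (of_real m) ** sigma3 + mat (of_real c)) *v z) $ 2
     = w $ 1 + of_real (c - m) * z $ 2"
  by (simp_all add: sigma2_def sigma3_def matrix_vector_mult_def matrix_matrix_mult_def mat_def sum_2 algebra_simps)

lemma dirac_solution_continuous:
  "dirac_solution m q \<zeta> y r \<Longrightarrow> continuous_on S y"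
  by (simp add: dirac_solution_def loc_abs_continuous_imp_continuous_on)

lemma fundamental_matrix_solution:
  assumes "fundamental_matrix m q \<zeta> \<Phi>"
  shows "dirac_solution m q \<zeta> (\<lambda>x. \<Phi> x *v v) (\<lambda>x. 0)"
proof -
  have lac: "loc_abs_continuous (\<lambda>x. \<Phi> x *v v)"
    using assms unfolding fundamental_matrix_def
    by (auto intro: loc_abs_continuous_bounded_linear[OF bounded_linear_matrix_vector_mult_left])
  have ae: "AE x in lebesgue. \<exists>\<Phi>'. (\<Phi> has_vector_derivative \<Phi>') (at x) \<and>
        mat (-\<i>) ** sigma2 ** \<Phi>' + (mat (of_real m) ** sigma3 + mat (of_real (q x))) ** \<Phi> x
          = mat \<zeta> ** \<Phi> x"
    using assms unfolding fundamental_matrix_def by blast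
  have "AE x in lebesgue. \<exists>y'. ((\<lambda>x. \<Phi> x *v v) has_vector_derivative y') (at x) \<and>
        - y' $ 2 + (of_real (m + q x) - \<zeta>) * (\<Phi> x *v v) $ 1 = 0 \<and>
        y' $ 1 + (of_real (q x - m) - \<zeta>) * (\<Phi> x *v v) $ 2 = 0"
    using ae
  proof eventually_elim
    case (elim x)
    then obtain D where D: "(\<Phi> has_vector_derivative D) (at x)"
      "mat (-\<i>) ** sigma2 ** D + (mat (of_real m) ** sigma3 + mat (of_real (q x))) ** \<Phi> x
          = mat \<zeta> ** \<Phi> x" by blast
    have eq: "- D $ 2 $ j + (of_real (m + q x) - \<zeta>) * \<Phi> x $ 1 $ j = 0"
        "D $ 1 $ j + (of_real (q x - m) - \<zeta>) * \<Phi> x $ 2 $ j = 0" for j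
      using arg_cong[OF D(2), of "\<lambda>M. M $ 1 $ j"] arg_cong[OF D(2), of "\<lambda>M. M $ 2 $ j"]
      by (simp_all add: sigma2_def sigma3_def matrix_matrix_mult_def mat_def sum_2 algebra_simps)
    have "((\<lambda>x. \<Phi> x *v v) has_vector_derivative D *v v) (at x)"
      by (rule bounded_linear.has_vector_derivative[OF bounded_linear_matrix_vector_mult_left D(1)])
    moreover have "- (D *v v) $ 2 + (of_real (m + q x) - \<zeta>) * (\<Phi> x *v v) $ 1
       = (\<Sum>j\<in>UNIV. (- D $ 2 $ j + (of_real (m + q x) - \<zeta>) * \<Phi> x $ 1 $ j) * v $ j)"
      by (simp add: matrix_vector_mult_def sum_2 algebra_simps)
    moreover have "(D *v v) $ 1 + (of_real (q x - m) - \<zeta>) * (\<Phi> x *v v) $ 2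
       = (\<Sum>j\<in>UNIV. (D $ 1 $ j + (of_real (q x - m) - \<zeta>) * \<Phi> x $ 2 $ j) * v $ j)"
      by (simp add: matrix_vector_mult_def sum_2 algebra_simps)
    ultimately show ?case
      unfolding eq by auto
  qed
  with lac show ?thesis by (simp add: dirac_solution_def)
qed

text \<open>In the product rule the terms in m, q and \<zeta> occur twice with opposite signs, so
  the integrand involves the inhomogeneity alone. With \<open>r\<close> equal to -V u it is the
  bilinear pairing of \<open>y\<close> with V u.\<close>

lemma wedge_has_integral:
  assumes y: "dirac_solution m q \<zeta> y (\<lambda>x. 0)" and u: "dirac_solution m q \<zeta> u r" and "x \<le> z"
  shows "((\<lambda>t. - cdot (y t) (r t)) has_integral (wedge (y z) (u z) - wedge (y x) (u x))) {x..z}"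
proof (rule loc_abs_continuous_has_integral[OF _ \<open>x \<le> z\<close>])
  show "loc_abs_continuous (\<lambda>z. wedge (y z) (u z))"
    using y u unfolding dirac_solution_def
    by (blast intro: loc_abs_continuous_bounded_bilinear[OF bounded_bilinear_wedge])
  have "AE x in lebesgue. \<exists>y'. (y has_vector_derivative y') (at x) \<and>
        - y' $ 2 + (of_real (m + q x) - \<zeta>) * y x $ 1 = 0 \<and>
        y' $ 1 + (of_real (q x - m) - \<zeta>) * y x $ 2 = 0"
   and "AE x in lebesgue. \<exists>y'. (u has_vector_derivative y') (at x) \<and>
        - y' $ 2 + (of_real (m + q x) - \<zeta>) * u x $ 1 = r x $ 1 \<and>
        y' $ 1 + (of_real (q x - m) - \<zeta>) * u x $ 2 = r x $ 2"
    using y u unfolding dirac_solution_def by auto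
  then show "AE x in lebesgue. ((\<lambda>z. wedge (y z) (u z)) has_vector_derivative - cdot (y x) (r x)) (at x)"
  proof eventually_elim
    case (elim x)
    obtain y' where y': "(y has_vector_derivative y') (at x)"
        "- y' $ 2 + (of_real (m + q x) - \<zeta>) * y x $ 1 = 0"
        "y' $ 1 + (of_real (q x - m) - \<zeta>) * y x $ 2 = 0" using elim(1) by blast
    obtain u' where u': "(u has_vector_derivative u') (at x)"
        "- u' $ 2 + (of_real (m + q x) - \<zeta>) * u x $ 1 = r x $ 1"
        "u' $ 1 + (of_real (q x - m) - \<zeta>) * u x $ 2 = r x $ 2" using elim(2) by blast
    have y'2: "y' $ 2 = (of_real (m + q x) - \<zeta>) * y x $ 1"
      and y'1: "y' $ 1 = - ((of_real (q x - m) - \<zeta>) * y x $ 2)"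
      using y'(2,3) by (simp_all add: eq_neg_iff_add_eq_0)
    have "wedge (y x) u' + wedge y' (u x) = - cdot (y x) (r x)"
      unfolding cdot_def wedge_def u'(2,3)[symmetric] y'1 y'2 by (simp add: algebra_simps)
    then show ?case
      using bounded_bilinear.has_vector_derivative[OF bounded_bilinear_wedge y'(1) u'(1)] by simp
  qed
qed

lemma wedge_const:
  assumes y: "dirac_solution m q \<zeta> y (\<lambda>x. 0)" and u: "dirac_solution m q \<zeta> u (\<lambda>x. 0)"
  shows "wedge (y x) (u x) = wedge (y z) (u z)"
proof -
  have "wedge (y x) (u x) = wedge (y z) (u z)" if "x \<le> z" for x z
    using wedge_has_integral[OF y u that] by (simp add: cdot_def)
  then show ?thesis by (metis linear)
qed

text \<open>Constancy of the Wronskians with the columns of $\Phi$ makes any existence and uniqueness theory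
  for Caratheodory equations unnecessary.\<close>

lemma dirac_solution_unique:
  assumes \<Phi>: "fundamental_matrix m q \<zeta> \<Phi>"
    and y: "dirac_solution m q \<zeta> y (\<lambda>x. 0)" and z: "dirac_solution m q \<zeta> z (\<lambda>x. 0)"
    and "y x = z x"
  shows "y t = z t"
proof -
  define c where "c i s = \<Phi> s *v axis i 1" for i :: 2 and s
  have c: "dirac_solution m q \<zeta> (c i) (\<lambda>x. 0)" for i
    unfolding c_def by (rule fundamental_matrix_solution[OF \<Phi>])
  have "\<Phi> 0 = mat 1" using \<Phi> by (simp add: fundamental_matrix_def)
  then have "wedge (c 1 0) (c 2 0) = 1"
    by (simp add: c_def wedge_def axis_def)
  then have W: "wedge (c 1 t) (c 2 t) = 1"
    using wedge_const[OF c c, of 1 t 2 0] by simp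
  have "wedge (y t) (c i t) = wedge (z t) (c i t)" for i
    using wedge_const[OF y c, of t i x] wedge_const[OF z c, of t i x] \<open>y x = z x\<close> by simp
  then have "wedge (c 1 t) (c 2 t) *s y t = wedge (c 1 t) (c 2 t) *s z t"
    using wedge_cramer[of "c 1 t" "c 2 t" "y t"] wedge_cramer[of "c 1 t" "c 2 t" "z t"] by simp
  then show ?thesis by (simp add: W)
qed

lemma dirac_solution_translate:
  assumes "dirac_solution m q \<zeta> y (\<lambda>x. 0)" and q: "\<forall>x. q (x + a) = q x"
  shows "dirac_solution m q \<zeta> (\<lambda>x. y (x + a)) (\<lambda>x. 0)"
proof -
  let ?P = "\<lambda>x. \<exists>y'. (y has_vector_derivative y') (at x) \<and>
        - y' $ 2 + (of_real (m + q x) - \<zeta>) * y x $ 1 = 0 \<and>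
        y' $ 1 + (of_real (q x - m) - \<zeta>) * y x $ 2 = 0"
  have lac: "loc_abs_continuous y" and "AE x in lebesgue. ?P x"
    using assms(1) by (auto simp: dirac_solution_def)
  then obtain N where N: "negligible N" "\<And>x. x \<notin> N \<Longrightarrow> ?P x"
    unfolding eventually_ae_filter_negligible by blast
  have "AE x in lebesgue. ?P (x + a)"
    unfolding eventually_ae_filter_negligible
  proof (intro exI conjI subsetI)
    show "negligible ((+) (-a) ` N)" by (rule negligible_translation[OF N(1)])
    fix x assume "x \<in> {x. \<not> ?P (x + a)}"
    then have "x + a \<in> N" using N(2)[of "x + a"] by blast
    then show "x \<in> (+) (-a) ` N" by (intro image_eqI[of _ _ "x + a"]) auto
  qed
  then have "AE x in lebesgue. \<exists>y'. ((\<lambda>x. y (x + a)) has_vector_derivative y') (at x) \<and>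
        - y' $ 2 + (of_real (m + q x) - \<zeta>) * y (x + a) $ 1 = 0 \<and>
        y' $ 1 + (of_real (q x - m) - \<zeta>) * y (x + a) $ 2 = 0"
  proof eventually_elim
    case (elim x)
    then obtain y' where y': "(y has_vector_derivative y') (at (x + a))"
        "- y' $ 2 + (of_real (m + q x) - \<zeta>) * y (x + a) $ 1 = 0"
        "y' $ 1 + (of_real (q x - m) - \<zeta>) * y (x + a) $ 2 = 0" using q by auto
    have "((\<lambda>x. x + a) has_vector_derivative 1) (at x)"
      by (auto intro!: derivative_eq_intros)
    from vector_diff_chain_at[OF this y'(1)]
    have "((\<lambda>x. y (x + a)) has_vector_derivative y') (at x)" by (simp add: o_def)
    with y' show ?case by blast
  qed
  then show ?thesis
    using loc_abs_continuous_translate[OF lac] by (simp add: dirac_solution_def)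
qed

text \<open>By periodicity of \<open>q\<close> the shifted solution is again a solution; it agrees
  with \<rho> times the original one at 0, and uniqueness does the rest.\<close>

lemma floquet_solution:
  assumes \<Phi>: "fundamental_matrix m q \<zeta> \<Phi>" and q: "\<forall>x. q (x + a) = q x"
    and v: "\<Phi> a *v v = \<rho> *s v"
  shows "\<Phi> (x + a) *v v = \<rho> *s (\<Phi> x *v v)"
proof -
  have "\<Phi> 0 = mat 1" using \<Phi> by (simp add: fundamental_matrix_def)
  then have "\<Phi> (x + a) *v v = \<Phi> x *v (\<rho> *s v)"
    using dirac_solution_unique[OF \<Phi> dirac_solution_translate[OF fundamental_matrix_solution[OF \<Phi>] q]
        fundamental_matrix_solution[OF \<Phi>], where x = 0 and t = x] v by simp
  then show ?thesis by (simp add: vector_scalar_commute)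
qed

text \<open>Exchanges the L2 class \<open>f\<close> for its locally absolutely continuous
  representative \<open>u\<close>, to which determinants can be applied. The term with V is moved to
  the right-hand side, hence the minus sign.\<close>

lemma dirac_H_eigenfunction:
  assumes "dirac_H m q V f (\<lambda>x. \<zeta> *s f x)"
  obtains u where "AE x in lebesgue. u x = f x" "dirac_solution m q \<zeta> u (\<lambda>x. - (V x *v f x))"
    "in_L2 (\<lambda>x. V x *v f x)"
proof -
  obtain h where h: "dirac_H0 m q f h" "AE x in lebesgue. \<zeta> *s f x = h x + V x *v f x"
    and L2: "in_L2 (\<lambda>x. V x *v f x)"
    using assms unfolding dirac_H_def by blast
  obtain u where u: "AE x in lebesgue. u x = f x" "loc_abs_continuous u"
       "AE x in lebesgue. \<exists>u'. (u has_vector_derivative u') (at x) \<and>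
           h x = (-\<i>) *s (sigma2 *v u') + (mat (of_real m) ** sigma3 + mat (of_real (q x))) *v u x"
    using h(1) unfolding dirac_H0_def by blast
  have "AE x in lebesgue. \<exists>y'. (u has_vector_derivative y') (at x) \<and>
        - y' $ 2 + (of_real (m + q x) - \<zeta>) * u x $ 1 = (- (V x *v f x)) $ 1 \<and>
        y' $ 1 + (of_real (q x - m) - \<zeta>) * u x $ 2 = (- (V x *v f x)) $ 2"
    using u(1,3) h(2)
  proof eventually_elim
    case (elim x)
    then obtain u' where u': "(u has_vector_derivative u') (at x)"
        "\<zeta> *s u x = (-\<i>) *s (sigma2 *v u') + (mat (of_real m) ** sigma3 + mat (of_real (q x))) *v u x + V x *v f x"
      by metis
    have "\<zeta> * u x $ 1 = - u' $ 2 + of_real (m + q x) * u x $ 1 + (V x *v f x) $ 1"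
      using arg_cong[OF u'(2), of "\<lambda>w. w $ 1"] dirac_expression_components(1)[of u' m "q x" "u x"] by simp
    moreover have "\<zeta> * u x $ 2 = u' $ 1 + of_real (q x - m) * u x $ 2 + (V x *v f x) $ 2"
      using arg_cong[OF u'(2), of "\<lambda>w. w $ 2"] dirac_expression_components(2)[of u' m "q x" "u x"] by simp
    ultimately show ?case using u'(1)
      by (intro exI[of _ u']) (simp add: algebra_simps)
  qed
  with u(1,2) L2 that show thesis unfolding dirac_solution_def by blast
qed

section \<open>Eigenvectors of two by two matrices\<close>

lemma det_transpose_vector2:
  "det (transpose (vector [w1, w2]) :: complex^2^2) = wedge w1 w2"
  by (simp add: det_2 transpose_def wedge_def algebra_simps)

text \<open>If the determinant were 0, \<open>wedge_cramer\<close> would exhibit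
  \<open>wedge y v2 *s v1\<close> as a multiple of both eigenvectors. Applying \<open>A\<close> then
  multiplies it by \<open>e1\<close> and by \<open>e2\<close>, so it is 0 for every
  \<open>y\<close>, which forces \<open>v2 = 0\<close>.\<close>

lemma wedge_eigenvectors_nonzero:
  assumes "e1 \<noteq> e2" "is_eigenvector A e1 v1" "is_eigenvector A e2 v2"
  shows "wedge v1 v2 \<noteq> 0"
proof
  assume W: "wedge v1 v2 = 0"
  have v: "v1 \<noteq> 0" "v2 \<noteq> 0" "A *v v1 = e1 *s v1" "A *v v2 = e2 *s v2"
    using assms by (auto simp: is_eigenvector_def)
  have "wedge y v2 = 0" for y
  proof -
    have eq: "wedge y v2 *s v1 = wedge y v1 *s v2"
      using wedge_cramer[of v1 v2 y] W by simp
    have "e1 *s (wedge y v2 *s v1) = A *v (wedge y v2 *s v1)"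
      by (simp add: vector_scalar_commute v mult.commute)
    also have "\<dots> = e2 *s (wedge y v1 *s v2)"
      unfolding eq by (simp add: vector_scalar_commute v mult.commute)
    finally have "(e1 - e2) *s (wedge y v2 *s v1) = 0"
      by (auto simp: eq vector_sub_rdistrib)
    then have "wedge y v2 *s v1 = 0" using \<open>e1 \<noteq> e2\<close> unfolding vector_mul_eq_0 by auto
    then show ?thesis using v(1) unfolding vector_mul_eq_0 by auto
  qed
  from this[of "axis 1 1"] this[of "axis 2 1"] have "v2 = 0"
    by (simp add: wedge_def axis_def vec_eq_iff forall_2)
  with v show False by simp
qed

text \<open>Expand \<open>w\<close> in the basis \<open>v1\<close>, \<open>v2\<close> by Cramer's
  rule and compare coordinates in \<open>A *v w = e *s w\<close>. This is the classification behind
  the uniqueness in \<open>Gamma_mat\<close>.\<close>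

lemma eigenvector_cases:
  assumes "e1 \<noteq> e2" "is_eigenvector A e1 v1" "is_eigenvector A e2 v2" "is_eigenvector A e w"
  obtains c where "e = e1" "c \<noteq> 0" "w = c *s v1" | c where "e = e2" "c \<noteq> 0" "w = c *s v2"
proof -
  have W: "wedge v1 v2 \<noteq> 0" by (rule wedge_eigenvectors_nonzero[OF assms(1-3)])
  have v: "v1 \<noteq> 0" "v2 \<noteq> 0" "w \<noteq> 0" "A *v v1 = e1 *s v1" "A *v v2 = e2 *s v2" "A *v w = e *s w"
    using assms by (auto simp: is_eigenvector_def)
  define \<alpha> \<beta> where "\<alpha> = wedge w v2 / wedge v1 v2" and "\<beta> = - wedge w v1 / wedge v1 v2"
  have "w = (1 / wedge v1 v2) *s (wedge v1 v2 *s w)" using W by simp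
  also have "\<dots> = \<alpha> *s v1 + \<beta> *s v2"
    unfolding wedge_cramer[of v1 v2 w] \<alpha>_def \<beta>_def by (simp add: vec_eq_iff algebra_simps diff_divide_distrib)
  finally have w: "w = \<alpha> *s v1 + \<beta> *s v2" .
  have "e *s (\<alpha> *s v1 + \<beta> *s v2) = A *v (\<alpha> *s v1 + \<beta> *s v2)"
    using v(6) w by simp
  also have "\<dots> = (\<alpha> * e1) *s v1 + (\<beta> * e2) *s v2"
    by (simp add: matrix_vector_right_distrib vector_scalar_commute v)
  finally have eq: "e *s (\<alpha> *s v1 + \<beta> *s v2) = (\<alpha> * e1) *s v1 + (\<beta> * e2) *s v2" .
  have "\<alpha> * (e - e1) * wedge v1 v2 = 0"
    using arg_cong[OF eq, of "\<lambda>z. wedge z v2"] by (simp add: wedge_def algebra_simps)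
  moreover have "\<beta> * (e - e2) * wedge v1 v2 = 0"
    using arg_cong[OF eq, of "\<lambda>z. wedge v1 z"] by (simp add: wedge_def algebra_simps)
  ultimately have "\<alpha> = 0 \<or> e = e1" "\<beta> = 0 \<or> e = e2" using W by auto
  moreover have "\<alpha> \<noteq> 0 \<or> \<beta> \<noteq> 0" using w v(3) by auto
  ultimately show thesis using that w \<open>e1 \<noteq> e2\<close> by fastforce
qed

lemma wedge_smult: "wedge (c *s y) (d *s z) = c * d * wedge y z"
  by (simp add: wedge_def algebra_simps)

lemma wedge_commute: "wedge z y = - wedge y z"
  by (simp add: wedge_def algebra_simps)

text \<open>The definite description has a value only because all choices of eigenvectors give the
  same quotient: any two choices differ by scaling and possibly by an exchange, and the quotient is
  invariant under both.\<close>

lemma Gamma_mat_eq: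
  assumes "e1 \<noteq> e2" "is_eigenvector A e1 v1" "is_eigenvector A e2 v2"
  shows "Gamma_mat A = cmod (wedge v1 v2) / (norm v1 * norm v2)"
  unfolding Gamma_mat_def det_transpose_vector2
proof (rule the_equality)
  show "\<exists>e1 e2 w1 w2. e1 \<noteq> e2 \<and> is_eigenvector A e1 w1 \<and> is_eigenvector A e2 w2 \<and>
     cmod (wedge v1 v2) / (norm v1 * norm v2) = cmod (wedge w1 w2) / (norm w1 * norm w2)"
    using assms by blast
next
  fix r assume "\<exists>e1 e2 w1 w2. e1 \<noteq> e2 \<and> is_eigenvector A e1 w1 \<and> is_eigenvector A e2 w2 \<and>
     r = cmod (wedge w1 w2) / (norm w1 * norm w2)"
  then obtain f1 f2 w1 w2 where f: "f1 \<noteq> f2" "is_eigenvector A f1 w1" "is_eigenvector A f2 w2"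
     "r = cmod (wedge w1 w2) / (norm w1 * norm w2)" by blast
  have scale: "cmod (wedge (c *s y) (d *s z)) / (norm (c *s y) * norm (d *s z)) = cmod (wedge y z) / (norm y * norm z)"
    if "c \<noteq> 0" "d \<noteq> 0" for c d y z
    using that by (simp add: wedge_smult norm_smult_vec2 norm_mult)
  have comm: "cmod (wedge v2 v1) / (norm v2 * norm v1) = cmod (wedge v1 v2) / (norm v1 * norm v2)"
    by (simp add: wedge_commute[of v2 v1] mult.commute)
  show "r = cmod (wedge v1 v2) / (norm v1 * norm v2)"
    unfolding f(4)
    using f(1) scale comm
    by (rule_tac eigenvector_cases[OF assms f(2)]; rule_tac eigenvector_cases[OF assms f(3)]) auto
qed

section \<open>The integral inequality for eigenfunctions\<close>

lemma emeasure_half_line: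
  fixes x :: real
  shows "emeasure lebesgue {x..} = \<infinity>" "emeasure lebesgue {..x} = \<infinity>"
proof -
  have aux: "emeasure lebesgue S = \<infinity>" if S: "\<And>n::nat. {c n..c n + n} \<subseteq> S" "S \<in> sets lebesgue" for S :: "real set" and c
  proof (rule ccontr)
    assume "emeasure lebesgue S \<noteq> \<infinity>"
    then obtain r where r: "emeasure lebesgue S = ennreal r" "0 \<le> r"
      by (metis enn2real_nonneg ennreal_enn2real infinity_ennreal_def less_top)
    obtain n :: nat where "r < n" using reals_Archimedean2 by blast
    have "emeasure lebesgue {c n..c n + n} \<le> emeasure lebesgue S"
      using S by (intro emeasure_mono) auto
    then have "ennreal n \<le> ennreal r" using r by simp
    then show False using \<open>r < n\<close> r(2) by simp
  qed
  show "emeasure lebesgue {x..} = \<infinity>" by (rule aux[of "\<lambda>_. x"]) auto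
  show "emeasure lebesgue {..x} = \<infinity>" by (rule aux[of "\<lambda>n. x - n"]) auto
qed

text \<open>Takes the place of a limit at infinity along a half line $S$.\<close>

lemma square_integrable_infinite_measure_bound:
  fixes u :: "real \<Rightarrow> 'a::real_normed_vector"
  assumes u: "integrable lebesgue (\<lambda>x. (norm (u x))\<^sup>2)"
    and S: "S \<in> sets lebesgue" "emeasure lebesgue S = \<infinity>"
    and le: "\<And>y. y \<in> S \<Longrightarrow> c \<le> M * norm (u y) + I"
  shows "c \<le> I"
proof (rule ccontr)
  assume "\<not> c \<le> I"
  \<comment> \<open>On \<open>S\<close> the hypothesis now gives M |u| >= c - I > 0, so a positive
    constant would be square integrable on a set of infinite measure.\<close>
  then have d: "0 < c - I" by simp
  have "integrable lebesgue (\<lambda>y. indicator S y * (c - I)\<^sup>2)"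
  proof (rule Bochner_Integration.integrable_bound)
    show "integrable lebesgue (\<lambda>x. M\<^sup>2 * (norm (u x))\<^sup>2)" using u by simp
    show "AE x in lebesgue. norm (indicator S x * (c - I)\<^sup>2) \<le> norm (M\<^sup>2 * (norm (u x))\<^sup>2)"
    proof (rule AE_I2)
      fix x
      have "(c - I)\<^sup>2 \<le> (M * norm (u x))\<^sup>2" if "x \<in> S"
        using le[OF that] d by (intro power_mono) auto
      then show "norm (indicator S x * (c - I)\<^sup>2) \<le> norm (M\<^sup>2 * (norm (u x))\<^sup>2)"
        by (auto simp: indicator_def power_mult_distrib)
    qed
  qed (use S(1) in measurable)
  then have "integrable lebesgue (indicator S :: real \<Rightarrow> real)" using d by simp
  then show False using S by (simp add: integrable_indicator_iff)
qed

lemma exp_abs_integral: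
  fixes c x :: real assumes "0 < c"
  shows "integrable lebesgue (\<lambda>t. exp (- c * \<bar>x - t\<bar>))" "(LINT t|lebesgue. exp (- c * \<bar>x - t\<bar>)) = 2 / c"
proof -
  define g :: "real \<Rightarrow> real" where "g t = indicator {0..} t * exp (- c * t)" for t
  have gm [measurable]: "g \<in> borel_measurable borel" unfolding g_def by measurable
  have hi: "((\<lambda>t. exp (- c * t)) has_integral 1 / c) {0..}"
    using has_integral_exp_minus_to_infinity[OF assms, of 0] by simp
  have si: "set_integrable lebesgue {0..} (\<lambda>t. exp (- c * t))"
    by (rule nonnegative_absolutely_integrable_1) (use hi in \<open>auto intro: has_integral_integrable\<close>)
  have g: "integrable lborel g" "integral\<^sup>L lborel g = 1 / c"
  proof -
    have "integrable lebesgue g" using si by (simp add: set_integrable_def g_def[abs_def])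
    then show "integrable lborel g" by (simp add: integrable_completion)
    have "integral\<^sup>L lebesgue g = 1 / c"
      using set_lebesgue_integral_eq_integral(2)[OF si] integral_unique[OF hi]
      by (simp add: set_lebesgue_integral_def g_def[abs_def])
    then show "integral\<^sup>L lborel g = 1 / c" by (simp add: integral_completion)
  qed
  have i: "integrable lborel (\<lambda>t. g (x + -1 * t))" "integrable lborel (\<lambda>t. g (-x + 1 * t))"
    by (rule lborel_integrable_real_affine[OF g(1)]; simp)+
  have v: "(LINT t|lborel. g (x + -1 * t)) = 1 / c" "(LINT t|lborel. g (-x + 1 * t)) = 1 / c"
    using lborel_integral_real_affine[of "-1" g x] lborel_integral_real_affine[of 1 g "-x"] g(2) by simp_all
  \<comment> \<open>At \<open>t = x\<close> both half-line exponentials equal 1, so the sum is right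
    only almost everywhere.\<close>
  have ae: "AE t in lborel. exp (- c * \<bar>x - t\<bar>) = g (x + -1 * t) + g (-x + 1 * t)"
    using AE_lborel_singleton[of x]
    by eventually_elim (auto simp: g_def indicator_def abs_if)
  have m: "(\<lambda>t. exp (- c * \<bar>x - t\<bar>)) \<in> borel_measurable lborel" by measurable
  have "integrable lborel (\<lambda>t. exp (- c * \<bar>x - t\<bar>))"
    using Bochner_Integration.integrable_add[OF i] by (subst integrable_cong_AE[OF m _ ae]) auto
  then show "integrable lebesgue (\<lambda>t. exp (- c * \<bar>x - t\<bar>))"
    using m by (simp add: integrable_completion)
  have "(LINT t|lborel. exp (- c * \<bar>x - t\<bar>)) = (LINT t|lborel. g (x + -1 * t) + g (-x + 1 * t))"
    by (rule integral_cong_AE[OF m _ ae]) measurable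
  also have "\<dots> = 2 / c" using Bochner_Integration.integral_add[OF i] v by simp
  finally show "(LINT t|lebesgue. exp (- c * \<bar>x - t\<bar>)) = 2 / c"
    using m by (simp add: integral_completion)
qed

text \<open>Young's inequality, applied to the two factors divided by their norms, integrates to 1/p
  + 1/r = 1. If a norm is 0, no division is possible, but then the product vanishes almost
  everywhere.\<close>

lemma Holder_integral:
  fixes f g :: "'a \<Rightarrow> real"
  assumes pq: "1 < p" "1 < r" "1 / p + 1 / r = 1"
    and f: "f \<in> borel_measurable M" "\<And>x. 0 \<le> f x" "integrable M (\<lambda>x. f x powr p)"
    and g: "g \<in> borel_measurable M" "\<And>x. 0 \<le> g x" "integrable M (\<lambda>x. g x powr r)"
  shows "integrable M (\<lambda>x. f x * g x)"
    and "(LINT x|M. f x * g x) \<le> (LINT x|M. f x powr p) powr (1 / p) * (LINT x|M. g x powr r) powr (1 / r)"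
proof -
  show int: "integrable M (\<lambda>x. f x * g x)"
  proof (rule Bochner_Integration.integrable_bound)
    show "integrable M (\<lambda>x. f x powr p / p + g x powr r / r)" using f(3) g(3) by auto
    show "AE x in M. norm (f x * g x) \<le> norm (f x powr p / p + g x powr r / r)"
      using Youngs_inequality[OF pq f(2) g(2)] f(2) g(2) by (auto simp: order_trans[OF _ abs_ge_self])
  qed (use f g in measurable)
  define F G where "F = (LINT x|M. f x powr p)" and "G = (LINT x|M. g x powr r)"
  have nn: "0 \<le> F" "0 \<le> G" by (simp_all add: F_def G_def)
  show "(LINT x|M. f x * g x) \<le> F powr (1 / p) * G powr (1 / r)"
  proof (cases "F = 0 \<or> G = 0")
    case True
    have "AE x in M. f x * g x = 0"
      using True
    proof
      assume "F = 0"
      then have "AE x in M. f x powr p = 0"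
        using f by (simp add: F_def integral_nonneg_eq_0_iff_AE)
      then show ?thesis by eventually_elim auto
    next
      assume "G = 0"
      then have "AE x in M. g x powr r = 0"
        using g by (simp add: G_def integral_nonneg_eq_0_iff_AE)
      then show ?thesis by eventually_elim auto
    qed
    then have "(LINT x|M. f x * g x) = 0" by (rule integral_eq_zero_AE)
    then show ?thesis by simp
  next
    case False
    with nn have pos: "0 < F" "0 < G" by auto
    define a b where "a = F powr (1 / p)" and "b = G powr (1 / r)"
    have ab: "0 < a" "0 < b" "a powr p = F" "b powr r = G"
      using pos pq by (auto simp: a_def b_def powr_powr)
    have "(LINT x|M. f x * g x / (a * b)) \<le> (LINT x|M. f x powr p / (F * p) + g x powr r / (G * r))"
    proof (rule integral_mono)
      show "integrable M (\<lambda>x. f x powr p / (F * p) + g x powr r / (G * r))" using f(3) g(3) by auto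
      fix x
      have "f x * g x / (a * b) = (f x / a) * (g x / b)" by simp
      also have "\<dots> \<le> (f x / a) powr p / p + (g x / b) powr r / r"
        using f(2) g(2) ab by (intro Youngs_inequality[OF pq]) auto
      also have "\<dots> = f x powr p / (F * p) + g x powr r / (G * r)"
        using f(2) g(2) ab by (simp add: powr_divide)
      finally show "f x * g x / (a * b) \<le> f x powr p / (F * p) + g x powr r / (G * r)" .
    qed (use int in simp)
    also have "\<dots> = F / (F * p) + G / (G * r)"
      using f(3) g(3) by (simp add: F_def G_def)
    also have "\<dots> = 1" using pos pq by simp
    finally have "(LINT x|M. f x * g x) / (a * b) \<le> 1" by simp
    then show ?thesis using ab by (simp add: a_def b_def divide_le_eq)
  qed
qed

text \<open>The bound is uniform in \<open>x\<close>. With \<open>w\<close> equal to V u it shows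
  that an eigenfunction is bounded before anything is known about its supremum. The term 1/\<kappa>
  is the integral of the squared weight, in a b <= a^2 + b^2.\<close>

lemma exp_weight_bound:
  fixes w :: "real \<Rightarrow> 'a::euclidean_space"
  assumes w: "w \<in> borel_measurable lebesgue" "integrable lebesgue (\<lambda>t. (norm (w t))\<^sup>2)" and "0 < (\<kappa>::real)"
  shows "integrable lebesgue (\<lambda>t. exp (- \<kappa> * \<bar>x - t\<bar>) * norm (w t))"
    and "(LINT t|lebesgue. exp (- \<kappa> * \<bar>x - t\<bar>) * norm (w t)) \<le> 1 / \<kappa> + (LINT t|lebesgue. (norm (w t))\<^sup>2)"
proof -
  let ?b = "\<lambda>t. exp (- (2 * \<kappa>) * \<bar>x - t\<bar>) + (norm (w t))\<^sup>2"
  have le: "exp (- \<kappa> * \<bar>x - t\<bar>) * norm (w t) \<le> ?b t" for t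
  proof -
    have ab: "a * b \<le> a * a + b * b" if "0 \<le> a" "0 \<le> b" for a b :: real
    proof -
      have "(a - b) * (a - b) = a * a - 2 * (a * b) + b * b" by (simp add: algebra_simps)
      then show ?thesis using mult_nonneg_nonneg[OF that] zero_le_square[of "a - b"] by linarith
    qed
    have "exp (- \<kappa> * \<bar>x - t\<bar>) * exp (- \<kappa> * \<bar>x - t\<bar>) = exp (- (2 * \<kappa>) * \<bar>x - t\<bar>)"
      by (simp add: exp_add[symmetric])
    then show ?thesis
      using ab[of "exp (- \<kappa> * \<bar>x - t\<bar>)" "norm (w t)"] by (simp add: power2_eq_square)
  qed
  have b1: "integrable lebesgue (\<lambda>t. exp (- (2 * \<kappa>) * \<bar>x - t\<bar>))"
    using \<open>0 < \<kappa>\<close> by (intro exp_abs_integral) simp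
  have b: "integrable lebesgue ?b" by (rule Bochner_Integration.integrable_add[OF b1 w(2)])
  show int: "integrable lebesgue (\<lambda>t. exp (- \<kappa> * \<bar>x - t\<bar>) * norm (w t))"
  proof (rule Bochner_Integration.integrable_bound[OF b])
    show "(\<lambda>t. exp (- \<kappa> * \<bar>x - t\<bar>) * norm (w t)) \<in> borel_measurable lebesgue"
      by (rule borel_measurable_times[OF borel_measurable_integrable[OF exp_abs_integral(1)[OF \<open>0 < \<kappa>\<close>]]
            measurable_compose[OF w(1) borel_measurable_norm]])
    show "AE t in lebesgue. norm (exp (- \<kappa> * \<bar>x - t\<bar>) * norm (w t)) \<le> norm (?b t)"
    proof (rule AE_I2)
      fix t
      have "norm (exp (- \<kappa> * \<bar>x - t\<bar>) * norm (w t)) = exp (- \<kappa> * \<bar>x - t\<bar>) * norm (w t)" by simp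
      also have "\<dots> \<le> ?b t" by (rule le)
      also have "\<dots> \<le> norm (?b t)" by simp
      finally show "norm (exp (- \<kappa> * \<bar>x - t\<bar>) * norm (w t)) \<le> norm (?b t)" .
    qed
  qed
  have "(LINT t|lebesgue. exp (- \<kappa> * \<bar>x - t\<bar>) * norm (w t)) \<le> (LINT t|lebesgue. ?b t)"
    by (rule integral_mono[OF int b le])
  also have "\<dots> = 2 / (2 * \<kappa>) + (LINT t|lebesgue. (norm (w t))\<^sup>2)"
    unfolding Bochner_Integration.integral_add[OF b1 w(2)]
    using exp_abs_integral(2)[of "2 * \<kappa>" x] \<open>0 < \<kappa>\<close> by simp
  finally show "(LINT t|lebesgue. exp (- \<kappa> * \<bar>x - t\<bar>) * norm (w t)) \<le> 1 / \<kappa> + (LINT t|lebesgue. (norm (w t))\<^sup>2)"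
    by simp
qed

lemma wedge_half_line_bound:
  assumes y: "dirac_solution m q \<zeta> y (\<lambda>x. 0)" and u: "dirac_solution m q \<zeta> u (\<lambda>t. - w t)"
    and w: "w \<in> borel_measurable lebesgue" "integrable lebesgue (\<lambda>t. (norm (w t))\<^sup>2)"
    and u2: "integrable lebesgue (\<lambda>t. (norm (u t))\<^sup>2)"
    and "0 < \<kappa>" "0 \<le> M"
    and T: "is_interval T" "x \<in> T" "T \<in> sets lebesgue" "emeasure lebesgue T = \<infinity>"
    and bound: "\<And>t. t \<in> T \<Longrightarrow> norm (y t) \<le> M * exp (- \<kappa> * \<bar>x - t\<bar>)"
  shows "norm (wedge (y x) (u x)) \<le> M * (LINT t|lebesgue. indicator T t * (exp (- \<kappa> * \<bar>x - t\<bar>) * norm (w t)))"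
    (is "_ \<le> M * ?I")
proof -
  let ?g = "\<lambda>t. indicator T t * (exp (- \<kappa> * \<bar>x - t\<bar>) * norm (w t))"
  have g: "integrable lebesgue ?g"
    using integrable_mult_indicator[OF T(3) exp_weight_bound(1)[OF w \<open>0 < \<kappa>\<close>]] by simp
  \<comment> \<open>The increment of the determinant comes as a gauge integral over a segment; it is
    compared with a Lebesgue integrable majorant and then enlarged to all of
    \<open>T\<close>.\<close>
  have seg: "norm (integral J (\<lambda>t. - cdot (y t) (- w t))) \<le> M * ?I"
    if int: "(\<lambda>t. - cdot (y t) (- w t)) integrable_on J" and J: "J \<subseteq> T" "J \<in> sets lebesgue" for J
  proof -
    have si: "set_integrable lebesgue J (\<lambda>t. M * ?g t)"
      unfolding set_integrable_def by (rule integrable_mult_indicator[OF J(2)]) (rule integrable_mult_right[OF g])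
    have "norm (integral J (\<lambda>t. - cdot (y t) (- w t))) \<le> integral J (\<lambda>t. M * ?g t)"
    proof (rule Henstock_Kurzweil_Integration.integral_norm_bound_integral)
      show "(\<lambda>t. M * ?g t) integrable_on J" by (rule set_lebesgue_integral_eq_integral(1)[OF si])
      fix t assume "t \<in> J"
      then have "t \<in> T" using J by auto
      have "norm (- cdot (y t) (- w t)) \<le> norm (y t) * norm (w t)"
        using norm_cdot_le[of "y t" "- w t"] by simp
      also have "\<dots> \<le> M * exp (- \<kappa> * \<bar>x - t\<bar>) * norm (w t)"
        by (intro mult_right_mono bound \<open>t \<in> T\<close>) simp
      finally show "norm (- cdot (y t) (- w t)) \<le> M * ?g t"
        using \<open>t \<in> T\<close> by (simp add: mult.assoc)
    qed (rule int)
    also have "\<dots> = (LINT t|lebesgue. indicator J t * (M * ?g t))"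
      unfolding set_lebesgue_integral_eq_integral(2)[OF si, symmetric]
      by (simp only: set_lebesgue_integral_def real_scaleR_def)
    also have "\<dots> \<le> (LINT t|lebesgue. M * ?g t)"
    proof (rule integral_mono)
      show "integrable lebesgue (\<lambda>t. indicator J t * (M * ?g t))"
        using si by (simp only: set_integrable_def real_scaleR_def)
      show "integrable lebesgue (\<lambda>t. M * ?g t)" by (rule integrable_mult_right[OF g])
      show "indicator J t * (M * ?g t) \<le> M * ?g t" for t
        using \<open>0 \<le> M\<close> by (auto simp: indicator_def)
    qed
    also have "\<dots> = M * ?I" by (rule integral_mult_right_zero)
    finally show ?thesis .
  qed
  have "norm (wedge (y x) (u x)) \<le> M * norm (u z) + M * ?I" if "z \<in> T" for z
  proof -
    have "norm (y z) \<le> M"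
    proof -
      have "exp (- \<kappa> * \<bar>x - z\<bar>) \<le> 1" using \<open>0 < \<kappa>\<close> by simp
      then have "M * exp (- \<kappa> * \<bar>x - z\<bar>) \<le> M * 1" using \<open>0 \<le> M\<close> by (rule mult_left_mono)
      then show ?thesis using bound[OF that] by simp
    qed
    then have yz: "norm (wedge (y z) (u z)) \<le> M * norm (u z)"
      by (intro order_trans[OF norm_wedge_le] mult_right_mono) auto
    have step: "norm (wedge (y t) (u t) - wedge (y s) (u s)) \<le> M * ?I" if st: "s \<le> t" "s \<in> T" "t \<in> T" for s t
    proof -
      have J: "{s..t} \<subseteq> T" "{s..t} \<in> sets lebesgue"
        using mem_is_interval_1_I[OF T(1) st(2,3)] by auto
      have hi: "((\<lambda>t. - cdot (y t) (- w t)) has_integral (wedge (y t) (u t) - wedge (y s) (u s))) {s..t}"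
        by (rule wedge_has_integral[OF y u st(1)])
      show ?thesis
        using seg[OF has_integral_integrable[OF hi] J] unfolding integral_unique[OF hi] .
    qed
    have "norm (wedge (y x) (u x) - wedge (y z) (u z)) \<le> M * ?I"
    proof (cases "x \<le> z")
      case True
      from step[OF this T(2) that] show ?thesis by (subst norm_minus_commute)
    next
      case False
      then show ?thesis using that T(2) by (intro step) auto
    qed
    then show ?thesis
      using yz norm_triangle_sub[of "wedge (y x) (u x)" "wedge (y z) (u z)"] by linarith
  qed
  then show ?thesis
    by (rule square_integrable_infinite_measure_bound[where S = T and u = u and M = M, OF u2 T(3,4)])
qed

text \<open>\<open>y1\<close> decays to the left and \<open>y2\<close> to the right, so each
  controls one determinant with \<open>u\<close>. In Cramer's rule the determinant with
  \<open>y2\<close> multiplies \<open>y1\<close> and vice versa; the factors exp(\<kappa> x) and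
  exp(-\<kappa> x) therefore cancel, and the two half-line integrals add up to the integral over the
  line.\<close>

lemma green_kernel_bound:
  assumes y1: "dirac_solution m q \<zeta> y1 (\<lambda>x. 0)" and y2: "dirac_solution m q \<zeta> y2 (\<lambda>x. 0)"
    and u: "dirac_solution m q \<zeta> u (\<lambda>t. - w t)"
    and w: "w \<in> borel_measurable lebesgue" "integrable lebesgue (\<lambda>t. (norm (w t))\<^sup>2)"
    and u2: "integrable lebesgue (\<lambda>t. (norm (u t))\<^sup>2)"
    and "0 < \<kappa>" "0 \<le> S1" "0 \<le> S2"
    and b1: "\<And>t. norm (y1 t) \<le> S1 * exp (\<kappa> * t)" and b2: "\<And>t. norm (y2 t) \<le> S2 * exp (- \<kappa> * t)"
  shows "integrable lebesgue (\<lambda>t. exp (- \<kappa> * \<bar>x - t\<bar>) * norm (w t))"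
    and "norm (wedge (y1 0) (y2 0)) * norm (u x) \<le> S1 * S2 * (LINT t|lebesgue. exp (- \<kappa> * \<bar>x - t\<bar>) * norm (w t))"
proof -
  let ?E = "\<lambda>t. exp (- \<kappa> * \<bar>x - t\<bar>) * norm (w t)"
  show int: "integrable lebesgue ?E" by (rule exp_weight_bound(1)[OF w \<open>0 < \<kappa>\<close>])
  let ?R = "LINT t|lebesgue. indicator {x..} t * ?E t"
  let ?L = "LINT t|lebesgue. indicator {..x} t * ?E t"
  have R: "norm (wedge (y2 x) (u x)) \<le> S2 * exp (- \<kappa> * x) * ?R"
  proof (rule wedge_half_line_bound[OF y2 u w u2 \<open>0 < \<kappa>\<close>])
    fix t assume "t \<in> {x..}"
    then have "exp (- \<kappa> * x) * exp (- \<kappa> * \<bar>x - t\<bar>) = exp (- \<kappa> * t)"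
      by (simp add: exp_add[symmetric] algebra_simps)
    then show "norm (y2 t) \<le> S2 * exp (- \<kappa> * x) * exp (- \<kappa> * \<bar>x - t\<bar>)"
      using b2[of t] by (simp add: mult.assoc)
  qed (use \<open>0 \<le> S2\<close> in \<open>auto simp: emeasure_half_line is_interval_ci\<close>)
  have L: "norm (wedge (y1 x) (u x)) \<le> S1 * exp (\<kappa> * x) * ?L"
  proof (rule wedge_half_line_bound[OF y1 u w u2 \<open>0 < \<kappa>\<close>])
    fix t assume "t \<in> {..x}"
    then have "exp (\<kappa> * x) * exp (- \<kappa> * \<bar>x - t\<bar>) = exp (\<kappa> * t)"
      by (simp add: exp_add[symmetric] algebra_simps)
    then show "norm (y1 t) \<le> S1 * exp (\<kappa> * x) * exp (- \<kappa> * \<bar>x - t\<bar>)"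
      using b1[of t] by (simp add: mult.assoc)
  qed (use \<open>0 \<le> S1\<close> in \<open>auto simp: emeasure_half_line is_interval_ic\<close>)
  have iR: "integrable lebesgue (\<lambda>t. indicator {x..} t * ?E t)"
    and iL: "integrable lebesgue (\<lambda>t. indicator {..x} t * ?E t)"
    using integrable_mult_indicator[OF _ int, of "{x..}"] integrable_mult_indicator[OF _ int, of "{..x}"]
    by simp_all
  \<comment> \<open>The two half lines share the point \<open>x\<close>, which is a null
    set.\<close>
  have "AE t in lborel. t \<noteq> x" using AE_lborel_singleton[of x] .
  then have "AE t in lebesgue. t \<noteq> x" by (rule AE_completion)
  then have "AE t in lebesgue. indicator {x..} t * ?E t + indicator {..x} t * ?E t = ?E t"
    by eventually_elim (auto simp: indicator_def)
  then have "(LINT t|lebesgue. indicator {x..} t * ?E t + indicator {..x} t * ?E t) = (LINT t|lebesgue. ?E t)"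
    by (intro integral_cong_AE) (use iR iL int in \<open>auto intro: borel_measurable_integrable\<close>)
  then have RL: "?R + ?L = (LINT t|lebesgue. ?E t)"
    using iR iL by (simp add: Bochner_Integration.integral_add)
  have nn: "0 \<le> ?R" "0 \<le> ?L" by (auto intro!: integral_nonneg_AE)
  \<comment> \<open>Cramer's rule is applied at \<open>x\<close>, but the constant determinant of
    \<open>y1\<close> and \<open>y2\<close> is read off at 0, where it is that of the initial
    vectors.\<close>
  have "wedge (y1 0) (y2 0) *s u x = wedge (y1 x) (y2 x) *s u x"
    using wedge_const[OF y1 y2, of 0 x] by simp
  also have "\<dots> = wedge (u x) (y2 x) *s y1 x - wedge (u x) (y1 x) *s y2 x" by (rule wedge_cramer)
  finally have "norm (wedge (y1 0) (y2 0)) * norm (u x) = norm (wedge (u x) (y2 x) *s y1 x - wedge (u x) (y1 x) *s y2 x)"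
    by (metis norm_smult_vec2)
  also have "\<dots> \<le> norm (wedge (y2 x) (u x)) * norm (y1 x) + norm (wedge (y1 x) (u x)) * norm (y2 x)"
    by (rule order_trans[OF norm_triangle_ineq4])
       (simp add: norm_smult_vec2 wedge_commute[of "u x"])
  also have "\<dots> \<le> (S2 * exp (- \<kappa> * x) * ?R) * (S1 * exp (\<kappa> * x)) + (S1 * exp (\<kappa> * x) * ?L) * (S2 * exp (- \<kappa> * x))"
    using R L b1[of x] b2[of x] nn \<open>0 \<le> S1\<close> \<open>0 \<le> S2\<close> by (intro add_mono mult_mono) auto
  also have "\<dots> = S1 * S2 * (?R + ?L) * (exp (- \<kappa> * x) * exp (\<kappa> * x))"
    by (simp add: algebra_simps)
  also have "exp (- \<kappa> * x) * exp (\<kappa> * x) = 1"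
    by (simp add: exp_add[symmetric])
  finally show "norm (wedge (y1 0) (y2 0)) * norm (u x) \<le> S1 * S2 * (LINT t|lebesgue. ?E t)"
    using RL by simp
qed

section \<open>Potentials in L^p against the exponential kernel\<close>

lemma norm_matrix_vector_le_opnorm: "norm (A *v x) \<le> opnorm A * norm x"
  unfolding opnorm_def
  by (rule onorm) (simp add: linear_conv_bounded_linear[symmetric])

lemma opnorm_nonneg: "0 \<le> opnorm A"
  unfolding opnorm_def by (rule onorm_pos_le) (simp add: linear_conv_bounded_linear[symmetric])

text \<open>Integrability of the p-th power includes its measurability; taking the p-th root carries
  it over to the operator norm itself.\<close>

lemma in_Lp_opnorm_measurable:
  assumes "in_Lp p V" "1 \<le> p"
  shows "(\<lambda>x. opnorm (V x)) \<in> borel_measurable lebesgue"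
proof -
  have "(\<lambda>x. opnorm (V x) powr p) \<in> borel_measurable lebesgue"
    using assms(1) by (simp add: in_Lp_def borel_measurable_integrable)
  then have "(\<lambda>x. (opnorm (V x) powr p) powr (1 / p)) \<in> borel_measurable lebesgue" by measurable
  then show ?thesis using assms(2) by (simp add: powr_powr opnorm_nonneg)
qed

text \<open>\<open>K\<close> is the norm of the exponential kernel in the space conjugate to L^p:
  its supremum 1 for p = 1, and otherwise the L^r norm with r = p/(p-1), computed from the integral
  2/(\<kappa> r). It is independent of \<open>x\<close> by translation invariance.\<close>

lemma exponential_convolution_Lp_bound:
  assumes "1 \<le> p" "in_Lp p V" "0 < \<kappa>"
  defines "K \<equiv> (if p = 1 then 1 else (2 * (p - 1) / (\<kappa> * p)) powr ((p - 1) / p))"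
  shows "integrable lebesgue (\<lambda>t. exp (- \<kappa> * \<bar>x - t\<bar>) * opnorm (V t))"
    and "(LINT t|lebesgue. exp (- \<kappa> * \<bar>x - t\<bar>) * opnorm (V t)) \<le> K * Lp_norm p V"
proof -
  let ?f = "\<lambda>t. exp (- \<kappa> * \<bar>x - t\<bar>)"
  have Vm [measurable]: "(\<lambda>x. opnorm (V x)) \<in> borel_measurable lebesgue"
    by (rule in_Lp_opnorm_measurable[OF assms(2,1)])
  have fm: "?f \<in> borel_measurable lebesgue"
    by (rule borel_measurable_integrable[OF exp_abs_integral(1)[OF \<open>0 < \<kappa>\<close>]])
  have Vp: "integrable lebesgue (\<lambda>x. opnorm (V x) powr p)" using assms(2) by (simp add: in_Lp_def)
  have "integrable lebesgue (\<lambda>t. ?f t * opnorm (V t)) \<and>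
      (LINT t|lebesgue. ?f t * opnorm (V t)) \<le> K * Lp_norm p V"
  proof (cases "p = 1")
    case True
    have V1: "integrable lebesgue (\<lambda>x. opnorm (V x))" using Vp True by (simp add: opnorm_nonneg)
    have le: "?f t * opnorm (V t) \<le> opnorm (V t)" for t
      using \<open>0 < \<kappa>\<close> opnorm_nonneg[of "V t"] by (intro mult_left_le_one_le) auto
    have int: "integrable lebesgue (\<lambda>t. ?f t * opnorm (V t))"
      by (rule Bochner_Integration.integrable_bound[OF V1])
         (use le borel_measurable_times[OF fm Vm] in \<open>auto simp: abs_mult opnorm_nonneg\<close>)
    have "(LINT t|lebesgue. ?f t * opnorm (V t)) \<le> (LINT t|lebesgue. opnorm (V t))"
      by (rule integral_mono[OF int V1 le])
    then show ?thesis using int True opnorm_nonneg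
      by (simp add: K_def Lp_norm_def integral_nonneg_AE)
  next
    case False
    with \<open>1 \<le> p\<close> have p: "1 < p" by simp
    define r where "r = p / (p - 1)"
    have r: "1 < r" "1 / r + 1 / p = 1" "1 / r = (p - 1) / p" "0 < \<kappa> * r"
      using p \<open>0 < \<kappa>\<close> by (auto simp: r_def field_simps)
    have fr: "?f t powr r = exp (- (\<kappa> * r) * \<bar>x - t\<bar>)" for t
      by (simp add: powr_def algebra_simps)
    have fi: "integrable lebesgue (\<lambda>t. ?f t powr r)"
      unfolding fr by (rule exp_abs_integral[OF r(4)])
    have fv: "(LINT t|lebesgue. ?f t powr r) = 2 * (p - 1) / (\<kappa> * p)"
      unfolding fr exp_abs_integral(2)[OF r(4)] using p by (simp add: r_def)

    show ?thesis
      using Holder_integral[OF r(1) p r(2) fm _ fi Vm opnorm_nonneg Vp, unfolded fv r(3)] False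
      by (simp add: K_def Lp_norm_def)
  qed
  then show "integrable lebesgue (\<lambda>t. exp (- \<kappa> * \<bar>x - t\<bar>) * opnorm (V t))"
    and "(LINT t|lebesgue. exp (- \<kappa> * \<bar>x - t\<bar>) * opnorm (V t)) \<le> K * Lp_norm p V" by auto
qed

text \<open>A contraction in the supremum norm: N = sup |u| satisfies W N <= S1 S2 K N, where S1 S2
  K < W by \<open>small\<close>. Once \<open>N\<close> is known to be finite, this leaves only N =
  0.\<close>

lemma no_eigenvalue_if_Green_bound:
  assumes y1: "dirac_solution m q \<zeta> y1 (\<lambda>x. 0)" and y2: "dirac_solution m q \<zeta> y2 (\<lambda>x. 0)"
    and "0 < \<kappa>" "0 \<le> S1" "0 \<le> S2"
    and b1: "\<And>t. norm (y1 t) \<le> S1 * exp (\<kappa> * t)" and b2: "\<And>t. norm (y2 t) \<le> S2 * exp (- \<kappa> * t)"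
    and p: "1 \<le> p" and V: "in_Lp p V"
    and small: "S1 * S2 * ((if p = 1 then 1 else (2 * (p - 1) / (\<kappa> * p)) powr ((p - 1) / p)) * Lp_norm p V)
       < norm (wedge (y1 0) (y2 0))"
  shows "\<not> is_eigenvalue (dirac_H m q V) \<zeta>"
proof
  assume "is_eigenvalue (dirac_H m q V) \<zeta>"
  then obtain f where f: "in_L2 f" "\<not> (AE x in lebesgue. f x = 0)" "dirac_H m q V f (\<lambda>x. \<zeta> *s f x)"
    unfolding is_eigenvalue_def by blast
  define w where "w x = V x *v f x" for x
  obtain u where uf: "AE x in lebesgue. u x = f x" and u: "dirac_solution m q \<zeta> u (\<lambda>x. - w x)" and "in_L2 w"
    using dirac_H_eigenfunction[OF f(3)] unfolding w_def[abs_def] by blast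
  then have w: "w \<in> borel_measurable lebesgue" "integrable lebesgue (\<lambda>t. (norm (w t))\<^sup>2)"
    by (auto simp: in_L2_def)
  have [measurable]: "f \<in> borel_measurable lebesgue" and f2: "integrable lebesgue (\<lambda>t. (norm (f t))\<^sup>2)"
    using f(1) by (auto simp: in_L2_def)
  have [measurable]: "u \<in> borel_measurable lebesgue"
    using dirac_solution_continuous[OF u, of UNIV] by (simp add: borel_measurable_continuous_onI measurable_completion)
  have u2: "integrable lebesgue (\<lambda>t. (norm (u t))\<^sup>2)"
    by (rule Bochner_Integration.integrable_cong_AE[THEN iffD2, OF _ _ _ f2]) (use uf in \<open>measurable, auto\<close>)
  define W where "W = norm (wedge (y1 0) (y2 0))"
  let ?E = "\<lambda>x t. exp (- \<kappa> * \<bar>x - t\<bar>)"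
  note green = green_kernel_bound[OF y1 y2 u w u2 assms(3-7), folded W_def]
  define K where "K = (if p = 1 then 1 else (2 * (p - 1) / (\<kappa> * p)) powr ((p - 1) / p)) * Lp_norm p V"
  have "0 \<le> K" by (simp add: K_def Lp_norm_def)
  have small': "S1 * S2 * K < W" using small by (simp add: K_def W_def)
  then have "0 < W" using \<open>0 \<le> K\<close> assms(4,5) by (smt (verit) mult_nonneg_nonneg)
  \<comment> \<open>Without finiteness of the supremum the contraction proves nothing. Here V u is
    estimated in L2, which is part of the domain condition of \<open>dirac_H\<close>, and not
    through sup |u|.\<close>
  have bdd: "\<exists>B. \<forall>x. norm (u x) \<le> B"
  proof (intro exI allI)
    fix x
    have "W * norm (u x) \<le> S1 * S2 * (1 / \<kappa> + (LINT t|lebesgue. (norm (w t))\<^sup>2))"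
      using assms(4,5) by (intro order_trans[OF green(2)] mult_left_mono exp_weight_bound w \<open>0 < \<kappa>\<close>) auto
    then show "norm (u x) \<le> S1 * S2 * (1 / \<kappa> + (LINT t|lebesgue. (norm (w t))\<^sup>2)) / W"
      using \<open>0 < W\<close> by (simp add: le_divide_eq mult.commute)
  qed
  then have bdd: "bdd_above (range (\<lambda>x. norm (u x)))" by (auto simp: bdd_above_def)
  define N where "N = (SUP x. norm (u x))"
  have uN: "norm (u x) \<le> N" for x unfolding N_def by (rule cSUP_upper[OF _ bdd]) simp
  have "0 \<le> N" using uN[of 0] norm_ge_zero order_trans by blast
  have "norm (u x) \<le> S1 * S2 * K * N / W" for x
  proof -
    note conv = exponential_convolution_Lp_bound[OF p V \<open>0 < \<kappa>\<close>, of x, folded K_def]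
    have "(LINT t|lebesgue. ?E x t * norm (w t)) \<le> (LINT t|lebesgue. ?E x t * opnorm (V t) * N)"
    proof (rule integral_mono_AE[OF green(1)])
      show "integrable lebesgue (\<lambda>t. ?E x t * opnorm (V t) * N)" using conv(1) by simp
      show "AE t in lebesgue. ?E x t * norm (w t) \<le> ?E x t * opnorm (V t) * N"
        using uf
      proof eventually_elim
        case (elim t)
        have "norm (w t) \<le> opnorm (V t) * norm (u t)"
          unfolding w_def elim by (rule norm_matrix_vector_le_opnorm)
        also have "\<dots> \<le> opnorm (V t) * N" by (intro mult_left_mono uN opnorm_nonneg)
        finally show ?case by (simp add: mult.assoc)
      qed
    qed
    also have "\<dots> \<le> K * N"
      using conv(2) \<open>0 \<le> N\<close> by (simp add: mult_right_mono)
    finally have "W * norm (u x) \<le> S1 * S2 * (K * N)"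
      using assms(4,5) by (intro order_trans[OF green(2)] mult_left_mono) auto
    then show ?thesis using \<open>0 < W\<close> by (simp add: le_divide_eq mult.commute mult.left_commute)
  qed
  then have "N \<le> S1 * S2 * K * N / W" unfolding N_def by (intro cSUP_least) auto
  then have "W * N \<le> S1 * S2 * K * N" using \<open>0 < W\<close> by (simp add: le_divide_eq mult.commute)
  then have "N = 0" using small' \<open>0 \<le> N\<close> by (metis less_eq_real_def linorder_not_less mult_less_cancel_right)
  then have "u x = 0" for x using uN[of x] by simp
  with uf have "AE x in lebesgue. f x = 0" by (auto elim: eventually_mono)
  with f(2) show False by contradiction
qed

section \<open>Singular sequences from bounded solutions\<close>

text \<open>Measures the error of a cutoff: this is the matrix that multiplies the derivative of the
  cutoff function.\<close>

lemma norm_dirac_symbol: "norm ((-\<i>) *s (sigma2 *v w)) = norm w"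
  by (simp add: norm_vec2 sigma2_def matrix_vector_mult_def sum_2 norm_mult add.commute)

section \<open>Square integrable functions and the action of the potential\<close>

lemma in_L2_bounded_support:
  assumes f: "f \<in> borel_measurable lebesgue" and "\<And>t. norm (f t) \<le> B * indicator {a..b} t"
  shows "in_L2 f" "(LINT t|lebesgue. (norm (f t))\<^sup>2) \<le> B\<^sup>2 * measure lebesgue {a..b}"
proof -
  have le: "(norm (f t))\<^sup>2 \<le> B\<^sup>2 * indicator {a..b} t" for t
  proof -
    have "(norm (f t))\<^sup>2 \<le> (B * indicator {a..b} t)\<^sup>2" using assms(2) by (intro power_mono) auto
    then show ?thesis by (cases "t \<in> {a..b}") (simp_all add: power_mult_distrib)
  qed
  have b: "integrable lebesgue (\<lambda>t. B\<^sup>2 * indicator {a..b} t)"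
    by (intro integrable_mult_right) (cases "a \<le> b"; simp add: integrable_indicator_iff)
  have fm: "(\<lambda>t. (norm (f t))\<^sup>2) \<in> borel_measurable lebesgue"
    by (intro borel_measurable_power measurable_compose[OF f borel_measurable_norm])
  have int: "integrable lebesgue (\<lambda>t. (norm (f t))\<^sup>2)"
    by (rule Bochner_Integration.integrable_bound[OF b fm]) (use le in auto)
  show "in_L2 f" using f int by (simp add: in_L2_def)
  have "(LINT t|lebesgue. (norm (f t))\<^sup>2) \<le> (LINT t|lebesgue. B\<^sup>2 * indicator {a..b} t)"
    by (rule integral_mono[OF int b le])
  then show "(LINT t|lebesgue. (norm (f t))\<^sup>2) \<le> B\<^sup>2 * measure lebesgue {a..b}" by simp
qed

lemma norm_add_square_le:
  fixes x y :: "'a::real_normed_vector"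
  shows "(norm (x + y))\<^sup>2 \<le> 2 * (norm x)\<^sup>2 + 2 * (norm y)\<^sup>2"
proof -
  have "(norm (x + y))\<^sup>2 \<le> (norm x + norm y)\<^sup>2" by (intro power_mono norm_triangle_ineq) simp
  also have "\<dots> \<le> 2 * (norm x)\<^sup>2 + 2 * (norm y)\<^sup>2"
    using zero_le_power2[of "norm x - norm y"] by (simp add: power2_eq_square algebra_simps)
  finally show ?thesis .
qed

lemma in_L2_add:
  assumes "in_L2 f" "in_L2 g"
  shows "in_L2 (\<lambda>x. f x + g x)"
    and "(LINT x|lebesgue. (norm (f x + g x))\<^sup>2)
      \<le> 2 * (LINT x|lebesgue. (norm (f x))\<^sup>2) + 2 * (LINT x|lebesgue. (norm (g x))\<^sup>2)"
proof -
  have m: "f \<in> borel_measurable lebesgue" "g \<in> borel_measurable lebesgue"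
    and i: "integrable lebesgue (\<lambda>x. (norm (f x))\<^sup>2)" "integrable lebesgue (\<lambda>x. (norm (g x))\<^sup>2)"
    using assms by (auto simp: in_L2_def)
  have fg: "(\<lambda>x. f x + g x) \<in> borel_measurable lebesgue" by (rule borel_measurable_add[OF m])
  have b: "integrable lebesgue (\<lambda>x. 2 * (norm (f x))\<^sup>2 + 2 * (norm (g x))\<^sup>2)"
    by (intro Bochner_Integration.integrable_add integrable_mult_right i)
  have int: "integrable lebesgue (\<lambda>x. (norm (f x + g x))\<^sup>2)"
    by (rule Bochner_Integration.integrable_bound[OF b])
       (auto intro!: borel_measurable_power measurable_compose[OF fg borel_measurable_norm] norm_add_square_le)
  show "in_L2 (\<lambda>x. f x + g x)" using fg int by (simp add: in_L2_def)
  have "(LINT x|lebesgue. (norm (f x + g x))\<^sup>2) \<le> (LINT x|lebesgue. 2 * (norm (f x))\<^sup>2 + 2 * (norm (g x))\<^sup>2)"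
    by (rule integral_mono[OF int b norm_add_square_le])
  also have "\<dots> = 2 * (LINT x|lebesgue. (norm (f x))\<^sup>2) + 2 * (LINT x|lebesgue. (norm (g x))\<^sup>2)"
    using i by simp
  finally show "(LINT x|lebesgue. (norm (f x + g x))\<^sup>2)
      \<le> 2 * (LINT x|lebesgue. (norm (f x))\<^sup>2) + 2 * (LINT x|lebesgue. (norm (g x))\<^sup>2)" .
qed

lemma borel_measurable_smult_vec:
  fixes f :: "'a \<Rightarrow> complex^2"
  assumes "f \<in> borel_measurable M"
  shows "(\<lambda>x. c *s f x) \<in> borel_measurable M"
proof -
  have "linear (\<lambda>v :: complex^2. c *s v)"
    by (auto intro!: linearI simp: vec_eq_iff algebra_simps)
  then have "bounded_linear (\<lambda>v :: complex^2. c *s v)"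
    by (simp add: linear_conv_bounded_linear)
  then have "(\<lambda>v :: complex^2. c *s v) \<in> borel_measurable borel"
    by (rule borel_measurable_continuous_onI[OF linear_continuous_on])
  from measurable_compose[OF assms this] show ?thesis .
qed

lemma in_L2_smult:
  assumes "in_L2 f" shows "in_L2 (\<lambda>x. c *s f x)"
  using assms unfolding in_L2_def norm_smult_vec2 power_mult_distrib
  by (intro conjI borel_measurable_smult_vec integrable_mult_right) blast+

lemma borel_measurable_matrix_vector_mult:
  fixes A :: "'a \<Rightarrow> complex^2^2" and f :: "'a \<Rightarrow> complex^2"
  assumes "A \<in> borel_measurable M" "f \<in> borel_measurable M"
  shows "(\<lambda>x. A x *v f x) \<in> borel_measurable M"
proof (rule borel_measurable_continuous_Pair[OF assms])
  have "bounded_bilinear ((*v) :: complex^2^2 \<Rightarrow> _)"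
    unfolding bilinear_conv_bounded_bilinear[symmetric] bilinear_def
    by (auto intro!: linearI simp: vec_eq_iff matrix_vector_mult_def sum_2 algebra_simps)
  then show "continuous_on UNIV (\<lambda>x :: (complex^2^2) \<times> (complex^2). fst x *v snd x)"
    by (rule bounded_bilinear.continuous_on) (rule continuous_on_fst continuous_on_snd, rule continuous_on_id)+
qed

text \<open>|V f|^2 is at most B^2 times the square of the operator norm of V; one factor of this
  square is estimated by the essential bound and the other is integrated. Hence \<open>C\<close> is
  an essential bound times the L1 norm, and functions that tend uniformly to 0 are sent to functions
  that tend to 0 in L2.\<close>

lemma in_L2_potential:
  assumes V: "in_Lp 1 V" "in_Linf V"
  obtains C where "0 \<le> C"
    "\<And>f B. f \<in> borel_measurable lebesgue \<Longrightarrow> (\<And>t. norm (f t) \<le> B) \<Longrightarrow> in_L2 (\<lambda>x. V x *v f x)"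
    "\<And>f B. f \<in> borel_measurable lebesgue \<Longrightarrow> (\<And>t. norm (f t) \<le> B) \<Longrightarrow>
      (LINT x|lebesgue. (norm (V x *v f x))\<^sup>2) \<le> C * B\<^sup>2"
proof -
  have Vm: "V \<in> borel_measurable lebesgue" and V1: "integrable lebesgue (\<lambda>x. opnorm (V x))"
    using V(1) by (auto simp: in_Lp_def opnorm_nonneg)
  obtain C0 where C0: "AE x in lebesgue. opnorm (V x) \<le> C0" using V(2) by (auto simp: in_Linf_def)
  define C where "C = \<bar>C0\<bar> * (LINT x|lebesgue. opnorm (V x))"
  have C: "0 \<le> C" by (simp add: C_def integral_nonneg_AE opnorm_nonneg)
  have main: "in_L2 (\<lambda>x. V x *v f x) \<and> (LINT x|lebesgue. (norm (V x *v f x))\<^sup>2) \<le> C * B\<^sup>2"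
    if f: "f \<in> borel_measurable lebesgue" "\<And>t. norm (f t) \<le> B" for f :: "real \<Rightarrow> complex^2" and B
  proof -
    have le: "AE x in lebesgue. (norm (V x *v f x))\<^sup>2 \<le> \<bar>C0\<bar> * B\<^sup>2 * opnorm (V x)"
      using C0
    proof eventually_elim
      case (elim x)
      have "norm (V x *v f x) \<le> opnorm (V x) * B"
        by (rule order_trans[OF norm_matrix_vector_le_opnorm]) (intro mult_left_mono f(2) opnorm_nonneg)
      then have "(norm (V x *v f x))\<^sup>2 \<le> (opnorm (V x) * B)\<^sup>2" by (intro power_mono) auto
      also have "\<dots> = opnorm (V x) * (opnorm (V x) * B\<^sup>2)" by (simp add: power2_eq_square mult_ac)
      also have "\<dots> \<le> \<bar>C0\<bar> * (opnorm (V x) * B\<^sup>2)"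
        using elim opnorm_nonneg[of "V x"] by (intro mult_right_mono) auto
      finally show ?case by (simp add: mult_ac)
    qed
    have b: "integrable lebesgue (\<lambda>x. \<bar>C0\<bar> * B\<^sup>2 * opnorm (V x))" by (rule integrable_mult_right[OF V1])
    have m: "(\<lambda>x. V x *v f x) \<in> borel_measurable lebesgue"
      by (rule borel_measurable_matrix_vector_mult[OF Vm f(1)])
    have int: "integrable lebesgue (\<lambda>x. (norm (V x *v f x))\<^sup>2)"
    proof (rule Bochner_Integration.integrable_bound[OF b])
      show "(\<lambda>x. (norm (V x *v f x))\<^sup>2) \<in> borel_measurable lebesgue"
        by (intro borel_measurable_power measurable_compose[OF m borel_measurable_norm])
      show "AE x in lebesgue. norm ((norm (V x *v f x))\<^sup>2) \<le> norm (\<bar>C0\<bar> * B\<^sup>2 * opnorm (V x))"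
        using le by eventually_elim (simp add: opnorm_nonneg)
    qed
    have "(LINT x|lebesgue. (norm (V x *v f x))\<^sup>2) \<le> (LINT x|lebesgue. \<bar>C0\<bar> * B\<^sup>2 * opnorm (V x))"
      by (rule integral_mono_AE[OF int b le])
    also have "\<dots> = C * B\<^sup>2" by (simp add: C_def mult_ac)
    finally show ?thesis using m int by (simp add: in_L2_def)
  qed
  show thesis
  proof (rule that[OF C])
    fix f :: "real \<Rightarrow> complex^2" and B assume f: "f \<in> borel_measurable lebesgue" "\<And>t. norm (f t) \<le> B"
    show "in_L2 (\<lambda>x. V x *v f x)" "(LINT x|lebesgue. (norm (V x *v f x))\<^sup>2) \<le> C * B\<^sup>2"
      using main[OF f] by auto
  qed
qed

text \<open>By the product rule, and because \<open>y\<close> solves the homogeneous equation, the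
  cutoff produces no error other than the term with its derivative.\<close>

lemma cutoff_dirac_H0:
  assumes y: "dirac_solution m q \<zeta> y (\<lambda>x. 0)" and h: "loc_abs_continuous h"
    and h': "AE x in lebesgue. (h has_real_derivative h' x) (at x)"
    and L2: "in_L2 (\<lambda>x. h x *\<^sub>R y x)" "in_L2 (\<lambda>x. \<zeta> *s (h x *\<^sub>R y x) + h' x *\<^sub>R ((-\<i>) *s (sigma2 *v y x)))"
  shows "dirac_H0 m q (\<lambda>x. h x *\<^sub>R y x) (\<lambda>x. \<zeta> *s (h x *\<^sub>R y x) + h' x *\<^sub>R ((-\<i>) *s (sigma2 *v y x)))"
  unfolding dirac_H0_def
proof (intro conjI L2 exI[of _ "\<lambda>x. h x *\<^sub>R y x"])
  show "loc_abs_continuous (\<lambda>x. h x *\<^sub>R y x)"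
    by (rule loc_abs_continuous_bounded_bilinear[OF bounded_bilinear_scaleR h])
       (use y in \<open>simp add: dirac_solution_def\<close>)
  have "AE x in lebesgue. \<exists>y'. (y has_vector_derivative y') (at x) \<and>
        - y' $ 2 + (of_real (m + q x) - \<zeta>) * y x $ 1 = 0 \<and>
        y' $ 1 + (of_real (q x - m) - \<zeta>) * y x $ 2 = 0"
    using y by (simp add: dirac_solution_def)
  then show "AE x in lebesgue. \<exists>u'. ((\<lambda>x. h x *\<^sub>R y x) has_vector_derivative u') (at x) \<and>
      \<zeta> *s (h x *\<^sub>R y x) + h' x *\<^sub>R ((-\<i>) *s (sigma2 *v y x))
      = (-\<i>) *s (sigma2 *v u') + (mat (of_real m) ** sigma3 + mat (of_real (q x))) *v (h x *\<^sub>R y x)"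
    using h'
  proof eventually_elim
    case (elim x)
    then obtain y' where y': "(y has_vector_derivative y') (at x)"
        "- y' $ 2 + (of_real (m + q x) - \<zeta>) * y x $ 1 = 0"
        "y' $ 1 + (of_real (q x - m) - \<zeta>) * y x $ 2 = 0" by blast
    have y'2: "y' $ 2 = (of_real (m + q x) - \<zeta>) * y x $ 1"
      and y'1: "y' $ 1 = - ((of_real (q x - m) - \<zeta>) * y x $ 2)"
      using y'(2,3) by (simp_all add: eq_neg_iff_add_eq_0)
    let ?u' = "h x *\<^sub>R y' + h' x *\<^sub>R y x"
    have d: "((\<lambda>x. h x *\<^sub>R y x) has_vector_derivative ?u') (at x)"
      by (rule has_vector_derivative_scaleR[OF elim(2) y'(1)])
    have "\<zeta> *s (h x *\<^sub>R y x) + h' x *\<^sub>R ((-\<i>) *s (sigma2 *v y x))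
      = (-\<i>) *s (sigma2 *v ?u') + (mat (of_real m) ** sigma3 + mat (of_real (q x))) *v (h x *\<^sub>R y x)"
      unfolding vec_eq_iff forall_2 dirac_expression_components
      by (simp add: y'1 y'2 sigma2_def matrix_vector_mult_def sum_2) (simp add: scaleR_conv_of_real algebra_simps)
    with d show ?case by blast
  qed
qed simp

section \<open>Tent functions as cutoffs\<close>

definition tent :: "real \<Rightarrow> real \<Rightarrow> real" where
  "tent N t = max 0 (1 - \<bar>t\<bar> / N)"

text \<open>The value 0 at the kinks -N, 0 and N is a convention: the domain of
  \<open>dirac_H0\<close> asks for absolute continuity and a derivative almost everywhere, so
  corners do no harm.\<close>

definition tent_deriv :: "real \<Rightarrow> real \<Rightarrow> real" where
  "tent_deriv N t = (if - N < t \<and> t < 0 then 1 / N else if 0 < t \<and> t < N then - (1 / N) else 0)"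

lemma tent_bounds:
  assumes "0 < N"
  shows "0 \<le> tent N t" "tent N t \<le> 1" "\<not> \<bar>t\<bar> \<le> N \<Longrightarrow> tent N t = 0" "\<bar>t\<bar> \<le> N / 2 \<Longrightarrow> 1 / 2 \<le> tent N t"
    and "\<bar>tent N t - tent N s\<bar> \<le> 1 / N * \<bar>t - s\<bar>"
proof -
  show "0 \<le> tent N t" "tent N t \<le> 1" "\<not> \<bar>t\<bar> \<le> N \<Longrightarrow> tent N t = 0" "\<bar>t\<bar> \<le> N / 2 \<Longrightarrow> 1 / 2 \<le> tent N t"
    using assms by (auto simp: tent_def field_simps)
  have "\<bar>tent N t - tent N s\<bar> \<le> \<bar>(1 - \<bar>t\<bar> / N) - (1 - \<bar>s\<bar> / N)\<bar>"
    unfolding tent_def by linarith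
  also have "(1 - \<bar>t\<bar> / N) - (1 - \<bar>s\<bar> / N) = (\<bar>s\<bar> - \<bar>t\<bar>) / N"
    by (simp add: diff_divide_distrib)
  also have "\<bar>(\<bar>s\<bar> - \<bar>t\<bar>) / N\<bar> = \<bar>\<bar>s\<bar> - \<bar>t\<bar>\<bar> / N"
    using assms by (simp add: abs_divide)
  also have "\<dots> \<le> \<bar>t - s\<bar> / N" using assms by (intro divide_right_mono) auto
  finally show "\<bar>tent N t - tent N s\<bar> \<le> 1 / N * \<bar>t - s\<bar>" by simp
qed

lemma tent_deriv_bound: "0 < N \<Longrightarrow> \<bar>tent_deriv N t\<bar> \<le> 1 / N * indicator {-N..N} t"
  by (auto simp: tent_deriv_def)

lemma tent_deriv_measurable: "tent_deriv N \<in> borel_measurable lebesgue"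
proof -
  have "tent_deriv N \<in> borel_measurable borel" unfolding tent_deriv_def[abs_def] by measurable
  then show ?thesis by (simp add: measurable_completion)
qed

lemma tent_has_derivative:
  assumes "0 < N" "t \<notin> {-N, 0, N}"
  shows "(tent N has_real_derivative tent_deriv N t) (at t)"
proof -
  consider "t < - N" | "- N < t" "t < 0" | "0 < t" "t < N" | "N < t" using assms(2) by force
  then show ?thesis
  proof cases
    case 1
    then have "tent_deriv N t = 0" using assms by (simp add: tent_deriv_def)
    moreover have "(tent N has_real_derivative 0) (at t)"
      by (rule has_field_derivative_transform_within_open[of "\<lambda>_. 0" _ _ "{..<-N}"])
         (use 1 assms in \<open>auto simp: tent_def field_simps\<close>)
    ultimately show ?thesis by simp
  next
    case 2
    then have "tent_deriv N t = 1 / N" using assms by (simp add: tent_deriv_def)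
    moreover have "((\<lambda>s. 1 + s / N) has_real_derivative 1 / N) (at t)"
      using assms by (auto intro!: derivative_eq_intros)
    then have "(tent N has_real_derivative 1 / N) (at t)"
      by (rule has_field_derivative_transform_within_open[of _ _ _ "{-N<..<0}"])
         (use 2 assms in \<open>auto simp: tent_def field_simps\<close>)
    ultimately show ?thesis by simp
  next
    case 3
    then have "tent_deriv N t = - (1 / N)" using assms by (simp add: tent_deriv_def)
    moreover have "((\<lambda>s. 1 - s / N) has_real_derivative - (1 / N)) (at t)"
      using assms by (auto intro!: derivative_eq_intros)
    then have "(tent N has_real_derivative - (1 / N)) (at t)"
      by (rule has_field_derivative_transform_within_open[of _ _ _ "{0<..<N}"])
         (use 3 assms in \<open>auto simp: tent_def field_simps\<close>)
    ultimately show ?thesis by simp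
  next
    case 4
    then have "tent_deriv N t = 0" using assms by (simp add: tent_deriv_def)
    moreover have "(tent N has_real_derivative 0) (at t)"
      by (rule has_field_derivative_transform_within_open[of "\<lambda>_. 0" _ _ "{N<..}"])
         (use 4 assms in \<open>auto simp: tent_def field_simps\<close>)
    ultimately show ?thesis by simp
  qed
qed

text \<open>Far out, the test function has a small L2 tail while \<open>f n\<close> stays in the
  unit ball; on a fixed compact interval \<open>f n\<close> is uniformly small.\<close>

lemma weak_null_if_uniformly_null:
  fixes f :: "nat \<Rightarrow> real \<Rightarrow> complex^2" and h :: "real \<Rightarrow> complex^2"
  assumes f: "\<And>n. in_L2 (f n)" "\<And>n. (LINT x|lebesgue. (norm (f n x))\<^sup>2) \<le> 1"
    and B: "\<And>n x. norm (f n x) \<le> B n" "B \<longlonglongrightarrow> 0" and h: "in_L2 h"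
  shows "(\<lambda>n. LINT x|lebesgue. f n x \<bullet> h x) \<longlonglongrightarrow> 0"
proof (rule LIMSEQ_I)
  fix r :: real assume "0 < r"
  define e where "e = r / 2"
  have "0 < e" using \<open>0 < r\<close> by (simp add: e_def)
  have hi: "integrable lebesgue (\<lambda>x. (norm (h x))\<^sup>2)" using h by (simp add: in_L2_def)
  define T where "T k x = indicator {x. real k < \<bar>x\<bar>} x * (norm (h x))\<^sup>2" for k :: nat and x
  have S: "{x::real. real k < \<bar>x\<bar>} \<in> sets lebesgue" for k
  proof -
    have "open {x::real. real k < \<bar>x\<bar>}"
      by (rule open_Collect_less[OF continuous_on_const continuous_on_rabs[OF continuous_on_id]])
    then show ?thesis by simp
  qed
  have Ti: "integrable lebesgue (T k)" for k
    using integrable_mult_indicator[OF S hi, of k] by (simp add: T_def[abs_def])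
  have "(\<lambda>k. LINT x|lebesgue. T k x) \<longlonglongrightarrow> integral\<^sup>L lebesgue (\<lambda>x::real. 0::real)"
  proof (rule integral_dominated_convergence[where w = "\<lambda>x. (norm (h x))\<^sup>2"])
    show "integrable lebesgue (\<lambda>x. (norm (h x))\<^sup>2)" by (rule hi)
    show "T k \<in> borel_measurable lebesgue" for k by (rule borel_measurable_integrable[OF Ti])
    show "AE x in lebesgue. (\<lambda>k. T k x) \<longlonglongrightarrow> 0"
    proof (rule AE_I2)
      fix x
      obtain K where K: "\<bar>x\<bar> \<le> real K" using real_arch_simple[of "\<bar>x\<bar>"] ..
      have "T k x = 0" if "K \<le> k" for k
      proof -
        have "\<not> real k < \<bar>x\<bar>" using K that by linarith
        then show ?thesis by (simp add: T_def)
      qed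
      then have "\<forall>\<^sub>F k in sequentially. T k x = 0"
        by (rule eventually_sequentiallyI)
      then show "(\<lambda>k. T k x) \<longlonglongrightarrow> 0" by (rule tendsto_eventually)
    qed
    show "AE x in lebesgue. norm (T k x) \<le> (norm (h x))\<^sup>2" for k
      by (rule AE_I2) (auto simp: T_def indicator_def)
  qed simp
  then have "(\<lambda>k. LINT x|lebesgue. T k x) \<longlonglongrightarrow> 0" by simp
  then obtain k where k: "(LINT x|lebesgue. T k x) < e\<^sup>2"
    using order_tendstoD(2)[of _ 0 sequentially "e\<^sup>2"] \<open>0 < e\<close> eventually_happens by force
  \<comment> \<open>An upper bound for the integral of |h| over {-k..k}, from |h| <= 1 + |h|^2; the
    length of that interval gives 2 k.\<close>
  define L where "L = 2 * k + (LINT x|lebesgue. (norm (h x))\<^sup>2)"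
  have "(\<lambda>n. B n * L) \<longlonglongrightarrow> 0 * L" by (intro tendsto_mult B(2) tendsto_const)
  then have "\<forall>\<^sub>F n in sequentially. B n * L < e"
    using order_tendstoD(2)[of _ 0 sequentially e] \<open>0 < e\<close> by simp
  then obtain n0 where n0: "\<And>n. n \<ge> n0 \<Longrightarrow> B n * L < e" by (auto simp: eventually_sequentially)
  have "norm (LINT x|lebesgue. f n x \<bullet> h x) < r" if "n \<ge> n0" for n
  proof -
    have B0: "0 \<le> B n" using B(1)[of n 0] norm_ge_zero order_trans by blast
    have fi: "integrable lebesgue (\<lambda>x. (norm (f n x))\<^sup>2)" using f(1) by (simp add: in_L2_def)
    \<comment> \<open>The first bracket is a weighted form of 2 s t <= s^2 + t^2 for the tail; since
      its integral over |h|^2 is below e^2, it contributes at most e/2 + e/2. The second summand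
      covers {-k..k} and contributes less than \<open>e\<close>. Together this stays below 2 e =
      r.\<close>
    let ?b = "\<lambda>x. (e / 2 * (norm (f n x))\<^sup>2 + 1 / (2 * e) * T k x) + B n * (indicator {- real k..real k} x + (norm (h x))\<^sup>2)"
    have Ii: "integrable lebesgue (indicator {- real k..real k} :: real \<Rightarrow> real)"
      by (simp add: integrable_indicator_iff)
    have bi: "integrable lebesgue ?b"
      by (intro Bochner_Integration.integrable_add integrable_mult_right fi Ti Ii hi)
    have b: "norm (f n x \<bullet> h x) \<le> ?b x" for x
    proof (cases "real k < \<bar>x\<bar>")
      case True
      have "norm (f n x \<bullet> h x) \<le> norm (f n x) * norm (h x)" by (simp add: Cauchy_Schwarz_ineq2)
      also have "\<dots> \<le> e / 2 * (norm (f n x))\<^sup>2 + 1 / (2 * e) * (norm (h x))\<^sup>2"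
      proof -
        have "0 \<le> (e * norm (f n x) - norm (h x))\<^sup>2 / (2 * e)" using \<open>0 < e\<close> by simp
        also have "\<dots> = e / 2 * (norm (f n x))\<^sup>2 + 1 / (2 * e) * (norm (h x))\<^sup>2 - norm (f n x) * norm (h x)"
          using \<open>0 < e\<close> by (simp add: power2_eq_square field_simps)
        finally show ?thesis by simp
      qed
      also have "\<dots> \<le> ?b x" using True B0 by (simp add: T_def indicator_def)
      finally show ?thesis .
    next
      case False
      have "norm (f n x \<bullet> h x) \<le> norm (f n x) * norm (h x)" by (simp add: Cauchy_Schwarz_ineq2)
      also have "\<dots> \<le> B n * (1 + (norm (h x))\<^sup>2)"
      proof (rule mult_mono[OF B(1) _ B0])
        have "0 \<le> (norm (h x) - 1 / 2)\<^sup>2" by simp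
        then show "norm (h x) \<le> 1 + (norm (h x))\<^sup>2" by (simp add: power2_eq_square algebra_simps)
      qed simp
      also have "\<dots> \<le> ?b x" using False \<open>0 < e\<close> by (auto simp: T_def indicator_def)
      finally show ?thesis .
    qed
    have "norm (LINT x|lebesgue. f n x \<bullet> h x) \<le> (LINT x|lebesgue. norm (f n x \<bullet> h x))"
      by (rule integral_norm_bound)
    also have "\<dots> \<le> (LINT x|lebesgue. ?b x)"
      by (rule integral_mono'[OF bi b]) (rule order_trans[OF norm_ge_zero b])
    also have "\<dots> = (e / 2 * (LINT x|lebesgue. (norm (f n x))\<^sup>2) + 1 / (2 * e) * (LINT x|lebesgue. T k x)) + B n * L"
      using fi Ti Ii hi by (simp add: L_def Bochner_Integration.integral_add)
    also have "\<dots> < (e / 2 * 1 + 1 / (2 * e) * e\<^sup>2) + e"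
      using k f(2)[of n] n0[OF that] \<open>0 < e\<close>
      by (intro add_le_less_mono add_mono mult_left_mono) auto
    also have "\<dots> = r" using \<open>0 < e\<close> by (simp add: e_def power2_eq_square)
    finally show ?thesis .
  qed
  then show "\<exists>no. \<forall>n\<ge>no. norm ((LINT x|lebesgue. f n x \<bullet> h x) - 0) < r" by auto
qed

text \<open>The lower bound \<open>c\<close> makes the squared norm of the cut-off solution grow at
  least like N, while \<open>C\<close> keeps it bounded pointwise. After normalisation it is
  uniformly of order N^(-1/2), which gives weak convergence to 0 and a vanishing contribution of V;
  the slope 1/N of the tent makes the remaining error smaller still.\<close>

lemma bounded_solution_in_essential_spectrum:
  assumes y: "dirac_solution m q \<zeta> y (\<lambda>x. 0)"
    and "0 < c" and c: "\<And>t. c \<le> norm (y t)" and C: "\<And>t. norm (y t) \<le> C"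
    and V: "in_Lp 1 V" "in_Linf V"
  shows "\<zeta> \<in> essential_spectrum (dirac_H m q V)"
proof -
  obtain K where K: "0 \<le> K"
    "\<And>f B. f \<in> borel_measurable lebesgue \<Longrightarrow> (\<And>t. norm (f t) \<le> B) \<Longrightarrow> in_L2 (\<lambda>x. V x *v f x)"
    "\<And>f B. f \<in> borel_measurable lebesgue \<Longrightarrow> (\<And>t. norm (f t) \<le> B) \<Longrightarrow>
      (LINT x|lebesgue. (norm (V x *v f x))\<^sup>2) \<le> K * B\<^sup>2"
    by (rule in_L2_potential[OF V]) blast
  have "0 \<le> C" using C[of 0] norm_ge_zero order_trans by blast
  have lacy: "loc_abs_continuous y" using y by (simp add: dirac_solution_def)
  have ym: "y \<in> borel_measurable lebesgue"
    using dirac_solution_continuous[OF y, of UNIV] by (simp add: borel_measurable_continuous_onI measurable_completion)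
  \<comment> \<open>The successor keeps the width of the tent positive at n = 0.\<close>
  define N where "N n = real (Suc n)" for n
  have N: "0 < N n" "1 \<le> N n" for n by (auto simp: N_def)
  have lact: "loc_abs_continuous (tent (N n))" for n
    by (rule loc_abs_continuous_lipschitz[of _ "1 / N n"])
       (use tent_bounds(5)[OF N(1)[of n]] N(1)[of n] in \<open>auto simp: less_imp_le\<close>)
  have tm: "tent (N n) \<in> borel_measurable lebesgue" for n
    using loc_abs_continuous_imp_continuous_on[OF lact, of UNIV]
    by (simp add: borel_measurable_continuous_onI measurable_completion)
  define I where "I n = (LINT t|lebesgue. (norm (tent (N n) t *\<^sub>R y t))\<^sup>2)" for n
  have tym: "(\<lambda>t. tent (N n) t *\<^sub>R y t) \<in> borel_measurable lebesgue" for n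
    by (rule borel_measurable_scaleR[OF tm ym])
  have ty: "norm (tent (N n) t *\<^sub>R y t) \<le> C * indicator {-N n..N n} t" for n t
  proof (cases "\<bar>t\<bar> \<le> N n")
    case True
    have "norm (tent (N n) t *\<^sub>R y t) \<le> 1 * C"
      unfolding norm_scaleR using tent_bounds(1,2)[OF N(1), of n t] C[of t] by (intro mult_mono) auto
    then show ?thesis using True by (simp add: abs_le_iff)
  next
    case False
    then show ?thesis using tent_bounds(3)[OF N(1) False] \<open>0 \<le> C\<close> by simp
  qed
  have tyi: "integrable lebesgue (\<lambda>t. (norm (tent (N n) t *\<^sub>R y t))\<^sup>2)" for n
    using in_L2_bounded_support(1)[OF tym ty] by (simp add: in_L2_def)
  \<comment> \<open>On the middle half, an interval of length \<open>N n\<close>, the tent is at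
    least 1/2 and the solution at least \<open>c\<close> in norm.\<close>
  have I: "c\<^sup>2 / 4 * N n \<le> I n" for n
  proof -
    have "(LINT t|lebesgue. c\<^sup>2 / 4 * indicator {- (N n / 2)..N n / 2} t) \<le> I n"
      unfolding I_def
    proof (rule integral_mono[OF _ tyi])
      show "integrable lebesgue (\<lambda>t. c\<^sup>2 / 4 * indicator {- (N n / 2)..N n / 2} t)"
        using N(1)[of n] by (intro integrable_mult_right) (simp add: integrable_indicator_iff)
      fix t
      show "c\<^sup>2 / 4 * indicator {- (N n / 2)..N n / 2} t \<le> (norm (tent (N n) t *\<^sub>R y t))\<^sup>2"
      proof (cases "\<bar>t\<bar> \<le> N n / 2")
        case True
        have "1 / 2 * c \<le> norm (tent (N n) t *\<^sub>R y t)"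
          unfolding norm_scaleR using tent_bounds(1,4)[OF N(1)[of n], of t] True c[of t] \<open>0 < c\<close>
          by (intro mult_mono) auto
        then have "(1 / 2 * c)\<^sup>2 \<le> (norm (tent (N n) t *\<^sub>R y t))\<^sup>2"
          using \<open>0 < c\<close> by (intro power_mono) auto
        moreover have "(1 / 2 * c)\<^sup>2 = c\<^sup>2 / 4" by (simp add: power2_eq_square)
        moreover have "t \<in> {- (N n / 2)..N n / 2}" using True by auto
        ultimately show ?thesis by simp
      next
        case False
        then have "t \<notin> {- (N n / 2)..N n / 2}" by auto
        then show ?thesis by simp
      qed
    qed
    then show ?thesis using N(1)[of n] by simp
  qed
  define A where "A n = sqrt (I n)" for n
  have Ipos: "0 < I n" for n
    using I[of n] N(1)[of n] \<open>0 < c\<close> by (smt (verit) divide_pos_pos mult_pos_pos zero_less_power)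
  then have A: "0 < A n" "(A n)\<^sup>2 = I n" for n by (auto simp: A_def less_imp_le)
  have invA: "1 / (A n)\<^sup>2 \<le> 4 / c\<^sup>2 / N n" for n
  proof -
    have "1 / I n \<le> 1 / (c\<^sup>2 / 4 * N n)"
      using I[of n] N(1)[of n] \<open>0 < c\<close> Ipos[of n] by (intro divide_left_mono mult_pos_pos) auto
    then show ?thesis by (simp add: A(2))
  qed
  define h where "h n t = tent (N n) t / A n" for n t
  define h' where "h' n t = tent_deriv (N n) t / A n" for n t
  define f where "f n t = h n t *\<^sub>R y t" for n t
  define z where "z n t = h' n t *\<^sub>R ((-\<i>) *s (sigma2 *v y t))" for n t
  \<comment> \<open>This is H applied to \<open>f n\<close>; subtracting \<zeta> times
    \<open>f n\<close> leaves the cutoff error \<open>z n\<close> and the potential term.\<close>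
  define g where "g n t = (\<zeta> *s f n t + z n t) + V t *v f n t" for n t
  have f_eq: "f n t = (1 / A n) *\<^sub>R (tent (N n) t *\<^sub>R y t)" for n t by (simp add: f_def h_def)
  have fm: "f n \<in> borel_measurable lebesgue" for n
    unfolding f_eq[abs_def] by (rule borel_measurable_scaleR[OF borel_measurable_const tym])
  have fb: "norm (f n t) \<le> C / A n * indicator {-N n..N n} t" for n t
  proof -
    have "norm (f n t) = 1 / A n * norm (tent (N n) t *\<^sub>R y t)" unfolding f_eq using A(1)[of n] by simp
    also have "\<dots> \<le> 1 / A n * (C * indicator {-N n..N n} t)"
      using A(1)[of n] by (intro mult_left_mono ty) auto
    finally show ?thesis by simp
  qed
  have fb': "norm (f n t) \<le> C / A n" for n t
    by (rule order_trans[OF fb]) (use \<open>0 \<le> C\<close> A(1)[of n] in \<open>simp add: indicator_def\<close>)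
  have fL2: "in_L2 (f n)" for n by (rule in_L2_bounded_support(1)[OF fm fb])
  have f1: "(LINT t|lebesgue. (norm (f n t))\<^sup>2) = 1" for n
  proof -
    have "(LINT t|lebesgue. (norm (f n t))\<^sup>2) = (LINT t|lebesgue. 1 / I n * (norm (tent (N n) t *\<^sub>R y t))\<^sup>2)"
      unfolding f_eq norm_scaleR power_mult_distrib using A[of n] by (simp add: power_divide)
    also have "\<dots> = 1 / I n * I n" by (simp add: I_def)
    finally show ?thesis using Ipos[of n] by simp
  qed
  have zm: "z n \<in> borel_measurable lebesgue" for n
    unfolding z_def[abs_def] h'_def[abs_def]
    by (intro borel_measurable_scaleR borel_measurable_divide tent_deriv_measurable borel_measurable_const
        borel_measurable_smult_vec borel_measurable_matrix_vector_mult ym)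
  have zb: "norm (z n t) \<le> C / (N n * A n) * indicator {-N n..N n} t" for n t
  proof -
    have "norm (z n t) = \<bar>tent_deriv (N n) t\<bar> * norm (y t) / A n"
      unfolding z_def h'_def norm_scaleR norm_dirac_symbol using A(1)[of n] by simp
    also have "\<dots> \<le> 1 / N n * indicator {-N n..N n} t * C / A n"
      using A(1)[of n] N(1)[of n] by (intro divide_right_mono mult_mono tent_deriv_bound C) auto
    finally show ?thesis by (simp add: mult_ac)
  qed
  have zL2: "in_L2 (z n)" for n by (rule in_L2_bounded_support(1)[OF zm zb])
  have VL2: "in_L2 (\<lambda>x. V x *v f n x)" for n by (rule K(2)[OF fm fb'])
  have hL2: "in_L2 (\<lambda>x. \<zeta> *s f n x + z n x)" for n by (intro in_L2_add in_L2_smult fL2 zL2)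
  have gL2: "in_L2 (g n)" for n
    unfolding g_def[abs_def] by (rule in_L2_add(1)[OF hL2 VL2])
  have H0: "dirac_H0 m q (f n) (\<lambda>x. \<zeta> *s f n x + z n x)" for n
    unfolding f_def[abs_def] z_def
  proof (rule cutoff_dirac_H0[OF y])
    have "loc_abs_continuous (\<lambda>t. 1 / A n * tent (N n) t)"
      by (rule loc_abs_continuous_bounded_linear[OF bounded_linear_mult_right lact])
    then show "loc_abs_continuous (h n)" by (simp add: h_def[abs_def])
    have "AE x in lborel. x \<noteq> - N n" "AE x in lborel. x \<noteq> 0" "AE x in lborel. x \<noteq> N n"
      by (rule AE_lborel_singleton)+
    then have "AE x in lborel. x \<notin> {- N n, 0, N n}" by eventually_elim simp
    then have "AE x in lebesgue. x \<notin> {- N n, 0, N n}" by (rule AE_completion)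
    then show "AE x in lebesgue. (h n has_real_derivative h' n x) (at x)"
    proof eventually_elim
      case (elim x)
      show ?case unfolding h_def[abs_def] h'_def
        by (rule DERIV_cdivide[OF tent_has_derivative[OF N(1) elim]])
    qed
    show "in_L2 (\<lambda>x. h n x *\<^sub>R y x)" using fL2[of n] by (simp add: f_def[abs_def])
    show "in_L2 (\<lambda>x. \<zeta> *s (h n x *\<^sub>R y x) + h' n x *\<^sub>R ((-\<i>) *s (sigma2 *v y x)))"
      using hL2[of n] by (simp add: f_def[abs_def] z_def[abs_def])
  qed
  have T: "dirac_H m q V (f n) (g n)" for n
    unfolding dirac_H_def using gL2 VL2 H0 by (auto simp: g_def)
  have fn1: "L2_nrm (f n) = 1" for n by (simp add: L2_nrm_def f1)
  have weak: "(\<lambda>n. LINT x|lebesgue. f n x \<bullet> k x) \<longlonglongrightarrow> 0" if "in_L2 k" for k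
  proof (rule weak_null_if_uniformly_null[OF fL2 _ _ _ that])
    show "(LINT x|lebesgue. (norm (f n x))\<^sup>2) \<le> 1" for n by (simp add: f1)
    show "norm (f n x) \<le> sqrt (C\<^sup>2 * (4 / c\<^sup>2) / N n)" for n x
    proof (rule real_le_rsqrt)
      have "(norm (f n x))\<^sup>2 \<le> (C / A n)\<^sup>2" by (intro power_mono fb') simp
      also have "\<dots> = C\<^sup>2 * (1 / (A n)\<^sup>2)" by (simp add: power_divide)
      also have "\<dots> \<le> C\<^sup>2 * (4 / c\<^sup>2 / N n)" by (intro mult_left_mono invA) simp
      finally show "(norm (f n x))\<^sup>2 \<le> C\<^sup>2 * (4 / c\<^sup>2) / N n" by simp
    qed
    show "(\<lambda>n. sqrt (C\<^sup>2 * (4 / c\<^sup>2) / N n)) \<longlonglongrightarrow> 0"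
      using tendsto_real_sqrt[OF LIMSEQ_Suc[OF lim_const_over_n[of "C\<^sup>2 * (4 / c\<^sup>2)"]]] by (simp add: N_def)
  qed
  \<comment> \<open>4 C^2 comes from the cutoff error, supported on length 2 N, where a further
    factor 1/N is estimated by 1; 2 K C^2 comes from the potential, and 4 / c^2 from
    \<open>invA\<close>.\<close>
  define D where "D = (4 * C\<^sup>2 + 2 * K * C\<^sup>2) * (4 / c\<^sup>2)"
  have nrm: "L2_nrm (\<lambda>x. g n x - \<zeta> *s f n x) \<le> sqrt (D / N n)" for n
    unfolding L2_nrm_def
  proof (rule real_sqrt_le_mono)
    have "(LINT x|lebesgue. (norm (g n x - \<zeta> *s f n x))\<^sup>2) = (LINT x|lebesgue. (norm (z n x + V x *v f n x))\<^sup>2)"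
      by (simp add: g_def add.assoc)
    also have "\<dots> \<le> 2 * (LINT x|lebesgue. (norm (z n x))\<^sup>2) + 2 * (LINT x|lebesgue. (norm (V x *v f n x))\<^sup>2)"
      by (rule in_L2_add(2)[OF zL2 VL2])
    also have "\<dots> \<le> 2 * ((C / (N n * A n))\<^sup>2 * measure lebesgue {-N n..N n}) + 2 * (K * (C / A n)\<^sup>2)"
      by (intro add_mono mult_left_mono in_L2_bounded_support(2)[OF zm zb] K(3)[OF fm fb']) auto
    also have "\<dots> = (4 * C\<^sup>2 * (1 / N n) + 2 * K * C\<^sup>2) * (1 / (A n)\<^sup>2)"
      using N(1)[of n] A(1)[of n] by (simp add: power_divide power_mult_distrib power2_eq_square field_simps)
    also have "\<dots> \<le> (4 * C\<^sup>2 * 1 + 2 * K * C\<^sup>2) * (4 / c\<^sup>2 / N n)"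
      using N[of n] K(1) by (intro mult_mono add_mono mult_left_mono invA) (auto simp: divide_le_eq)
    also have "\<dots> = D / N n" by (simp add: D_def)
    finally show "(LINT x|lebesgue. (norm (g n x - \<zeta> *s f n x))\<^sup>2) \<le> D / N n" .
  qed
  have lim0: "(\<lambda>n. sqrt (D / N n)) \<longlonglongrightarrow> 0"
    using tendsto_real_sqrt[OF LIMSEQ_Suc[OF lim_const_over_n[of D]]] by (simp add: N_def)
  have "(\<lambda>n. L2_nrm (\<lambda>x. g n x - \<zeta> *s f n x)) \<longlonglongrightarrow> 0"
  proof (rule tendsto_sandwich[OF _ _ tendsto_const lim0])
    show "\<forall>\<^sub>F n in sequentially. 0 \<le> L2_nrm (\<lambda>x. g n x - \<zeta> *s f n x)"
      by (intro always_eventually allI) (simp add: L2_nrm_def)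
    show "\<forall>\<^sub>F n in sequentially. L2_nrm (\<lambda>x. g n x - \<zeta> *s f n x) \<le> sqrt (D / N n)"
      by (intro always_eventually allI nrm)
  qed
  then show ?thesis
    unfolding essential_spectrum_def using T fn1 weak by blast
qed

section \<open>Floquet solutions\<close>

lemma periodic_reduce:
  fixes F :: "real \<Rightarrow> 'a"
  assumes "0 < a" and F: "\<And>x. F (x + a) = F x"
  obtains s where "s \<in> {0..a}" "F t = F s"
proof -
  have nat: "F (x + real n * a) = F x" for x n
  proof (induction n)
    case (Suc n)
    have "F (x + real (Suc n) * a) = F (x + real n * a + a)" by (simp add: algebra_simps)
    then show ?case using Suc F by simp
  qed simp
  define k where "k = \<lfloor>t / a\<rfloor>"
  have "of_int k \<le> t / a" "t / a < of_int k + 1" unfolding k_def by linarith+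
  then have s: "t - of_int k * a \<in> {0..a}"
    using \<open>0 < a\<close> by (auto simp: field_simps)
  have "F t = F (t - of_int k * a)"
  proof (cases "0 \<le> k")
    case True
    then show ?thesis using nat[of "t - of_int k * a" "nat k"] by simp
  next
    case False
    then show ?thesis using nat[of t "nat (- k)"] by simp
  qed
  with s that show thesis by blast
qed

text \<open>A real supremum is an upper bound only for a set that is bounded above; continuity on
  the compact period provides this, and periodicity extends the bound to the whole line.\<close>

lemma norm_le_SUP_over_period:
  fixes \<psi> :: "real \<Rightarrow> complex^2"
  assumes "0 < a" and cont: "continuous_on {0..a} \<psi>" and per: "\<And>x. norm (\<psi> (x + a)) = norm (\<psi> x)"
  shows "norm (\<psi> t) \<le> (SUP x\<in>{0..a}. norm (\<psi> x))"
proof -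
  have "compact ((\<lambda>x. norm (\<psi> x)) ` {0..a})"
    by (intro compact_continuous_image continuous_on_norm cont) simp
  then have "bdd_above ((\<lambda>x. norm (\<psi> x)) ` {0..a})"
    by (intro bounded_imp_bdd_above compact_imp_bounded)
  moreover obtain s where "s \<in> {0..a}" "norm (\<psi> t) = norm (\<psi> s)"
    using periodic_reduce[OF \<open>0 < a\<close>, of "\<lambda>x. norm (\<psi> x)"] per by blast
  ultimately show ?thesis by (metis cSUP_upper)
qed

text \<open>The reflection that defines \<open>k\<close> in the lower half plane changes the sign of
  the real part only.\<close>

lemma quasimomentum_Im_nonneg:
  assumes "is_quasimomentum a \<DD> k"
  shows "0 \<le> Im (k \<zeta>)"
proof (cases "0 \<le> Im \<zeta>")
  case True
  then show ?thesis using assms by (simp add: is_quasimomentum_def)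
next
  case False
  then have "k \<zeta> = - cnj (k (cnj \<zeta>))" "0 \<le> Im (k (cnj \<zeta>))"
    using assms by (auto simp: is_quasimomentum_def)
  then show ?thesis by (metis cnj.simps(2) minus_minus uminus_complex.simps(2))
qed

text \<open>A multiplier of modulus 1 makes the norm of the Floquet solution periodic. By uniqueness
  the solution never vanishes, so this norm has a positive minimum over a period, and a finite
  supremum. A single eigenvector is enough, so a monodromy matrix that is not diagonalisable is
  covered.\<close>

lemma unimodular_multiplier_in_essential_spectrum:
  assumes "0 < a" and q: "\<forall>x. q (x + a) = q x" and \<Phi>: "fundamental_matrix m q \<zeta> \<Phi>"
    and v: "is_eigenvector (\<Phi> a) \<rho> v" and "norm \<rho> = 1"
    and V: "in_Lp 1 V" "in_Linf V"
  shows "\<zeta> \<in> essential_spectrum (dirac_H m q V)"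
proof -
  let ?y = "\<lambda>x. \<Phi> x *v v"
  have v0: "v \<noteq> 0" and v1: "\<Phi> a *v v = \<rho> *s v" using v by (auto simp: is_eigenvector_def)
  have sol: "dirac_solution m q \<zeta> ?y (\<lambda>x. 0)" by (rule fundamental_matrix_solution[OF \<Phi>])
  have per: "norm (?y (x + a)) = norm (?y x)" for x
    using floquet_solution[OF \<Phi> q v1, of x] \<open>norm \<rho> = 1\<close> by (simp add: norm_smult_vec2)
  have nz: "?y t \<noteq> 0" for t
  proof
    assume "?y t = 0"
    then have "?y t = \<Phi> t *v 0" by simp
    from dirac_solution_unique[OF \<Phi> sol fundamental_matrix_solution[OF \<Phi>, of 0] this, of 0]
    have "\<Phi> 0 *v v = 0" by simp
    moreover have "\<Phi> 0 = mat 1" using \<Phi> by (simp add: fundamental_matrix_def)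
    ultimately show False using v0 by simp
  qed
  have cont: "continuous_on S (\<lambda>x. norm (?y x))" for S
    by (intro continuous_on_norm dirac_solution_continuous[OF sol])
  obtain t0 where t0: "\<And>t. t \<in> {0..a} \<Longrightarrow> norm (?y t0) \<le> norm (?y t)"
    using continuous_attains_inf[OF compact_Icc _ cont, of 0 a] \<open>0 < a\<close> by fastforce
  have low: "norm (?y t0) \<le> norm (?y t)" for t
  proof -
    obtain s where "s \<in> {0..a}" "norm (?y t) = norm (?y s)"
      using periodic_reduce[OF \<open>0 < a\<close>, of "\<lambda>x. norm (?y x)" t] per by blast
    then show ?thesis using t0 by metis
  qed
  show ?thesis
  proof (rule bounded_solution_in_essential_spectrum[OF sol _ low _ V])
    show "0 < norm (?y t0)" using nz by simp
    show "norm (?y t) \<le> (SUP x\<in>{0..a}. norm (?y x))" for t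
      by (rule norm_le_SUP_over_period[OF \<open>0 < a\<close> dirac_solution_continuous[OF sol] per])
  qed
qed

lemma continuous_on_smult_vec:
  fixes c :: "'a::topological_space \<Rightarrow> complex" and y :: "'a \<Rightarrow> complex^2"
  assumes "continuous_on S c" "continuous_on S y"
  shows "continuous_on S (\<lambda>x. c x *s y x)"
  unfolding vector_scalar_mult_def using assms by (intro continuous_intros)

theorem theorem3:
  fixes m a p :: real and q :: "real \<Rightarrow> real" and V :: "real \<Rightarrow> complex^2^2"
    and \<Phi> :: "complex \<Rightarrow> real \<Rightarrow> complex^2^2" and k :: "complex \<Rightarrow> complex"
    and \<zeta> :: complex and v_plus v_minus :: "complex^2"
  assumes "0 \<le> m" and "0 < a"
    and "locally_integrable q" and "\<forall>x. q (x + a) = q x"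
    and "\<forall>\<mu>. fundamental_matrix m q \<mu> (\<Phi> \<mu>)"
    and "is_quasimomentum a (\<lambda>\<mu>. trace (\<Phi> \<mu> a)) k"
    and "1 \<le> p" and "in_Lp p V" and "in_Linf V"
    and "\<zeta> \<notin> essential_spectrum (dirac_H m q V)"
    and "is_eigenvector (\<Phi> \<zeta> a) (exp (- \<i> * k \<zeta> * of_real a)) v_plus"
    and "is_eigenvector (\<Phi> \<zeta> a) (exp (\<i> * k \<zeta> * of_real a)) v_minus"
    and "p = 1 \<Longrightarrow> Lp_norm 1 V <
           Gamma_mat (\<Phi> \<zeta> a)
           * gamma_ratio a (floquet_plus (\<Phi> \<zeta>) (k \<zeta>) v_plus)
           * gamma_ratio a (floquet_minus (\<Phi> \<zeta>) (k \<zeta>) v_minus)"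
    and "p > 1 \<Longrightarrow> Lp_norm p V <
           Gamma_mat (\<Phi> \<zeta> a)
           * gamma_ratio a (floquet_plus (\<Phi> \<zeta>) (k \<zeta>) v_plus)
           * gamma_ratio a (floquet_minus (\<Phi> \<zeta>) (k \<zeta>) v_minus)
           * Im (k \<zeta>) powr ((p - 1) / p) * (p / (2 * (p - 1))) powr ((p - 1) / p)"
  shows "\<not> is_eigenvalue (dirac_H m q V) \<zeta>"
proof -
  note q = \<open>\<forall>x. q (x + a) = q x\<close> and p = \<open>1 \<le> p\<close> and V = \<open>in_Lp p V\<close>
  have \<Phi>: "fundamental_matrix m q \<zeta> (\<Phi> \<zeta>)" using assms(5) by blast
  define \<kappa> where "\<kappa> = Im (k \<zeta>)"
  have Lp0: "0 \<le> Lp_norm p V" by (simp add: Lp_norm_def)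
  have "0 \<le> \<kappa>" unfolding \<kappa>_def by (rule quasimomentum_Im_nonneg[OF assms(6)])
  have "\<kappa> \<noteq> 0"
  proof
    assume "\<kappa> = 0"
    show False
    \<comment> \<open>For p = 1 the potential is integrable, as the singular sequence requires. For
      p > 1 the factor \<open>Im (k \<zeta>) powr ((p - 1) / p)\<close> is 0, so the hypothesis
      would make a norm negative.\<close>
    proof (cases "p = 1")
      case True
      have "norm (exp (- \<i> * k \<zeta> * of_real a)) = 1"
        using \<open>\<kappa> = 0\<close> by (simp add: norm_exp_eq_Re \<kappa>_def)
      then show False
        using unimodular_multiplier_in_essential_spectrum[OF \<open>0 < a\<close> q \<Phi> assms(11)] V True assms(9,10) by blast
    next
      case False
      then have "Lp_norm p V < 0" using assms(14) p \<open>\<kappa> = 0\<close> by (simp add: \<kappa>_def)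
      with Lp0 show False by simp
    qed
  qed
  with \<open>0 \<le> \<kappa>\<close> have "0 < \<kappa>" by simp
  define \<rho>1 \<rho>2 where "\<rho>1 = exp (- \<i> * k \<zeta> * of_real a)" and "\<rho>2 = exp (\<i> * k \<zeta> * of_real a)"
  have v1: "v_plus \<noteq> 0" "\<Phi> \<zeta> a *v v_plus = \<rho>1 *s v_plus"
    and v2: "v_minus \<noteq> 0" "\<Phi> \<zeta> a *v v_minus = \<rho>2 *s v_minus"
    using assms(11,12) by (auto simp: is_eigenvector_def \<rho>1_def \<rho>2_def)
  have n\<rho>: "norm \<rho>1 = exp (\<kappa> * a)" "norm \<rho>2 = exp (- \<kappa> * a)"
    by (simp_all add: \<rho>1_def \<rho>2_def norm_exp_eq_Re \<kappa>_def)
  have "exp (- \<kappa> * a) < 1" "1 < exp (\<kappa> * a)" using \<open>0 < \<kappa>\<close> \<open>0 < a\<close> by simp_all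
  \<comment> \<open>The multipliers lie on different sides of the unit circle; their being distinct
    gives \<open>Gamma_mat\<close> its meaning.\<close>
  then have "\<rho>1 \<noteq> \<rho>2" using n\<rho> by (metis less_trans less_irrefl)
  define y1 y2 where "y1 x = \<Phi> \<zeta> x *v v_plus" and "y2 x = \<Phi> \<zeta> x *v v_minus" for x
  have sol: "dirac_solution m q \<zeta> y1 (\<lambda>x. 0)" "dirac_solution m q \<zeta> y2 (\<lambda>x. 0)"
    unfolding y1_def[abs_def] y2_def[abs_def] by (rule fundamental_matrix_solution[OF \<Phi>])+
  have \<Phi>0: "\<Phi> \<zeta> 0 = mat 1" using \<Phi> by (simp add: fundamental_matrix_def)
  have y0: "y1 0 = v_plus" "y2 0 = v_minus" by (simp_all add: y1_def y2_def \<Phi>0)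
  let ?f1 = "floquet_plus (\<Phi> \<zeta>) (k \<zeta>) v_plus" and ?f2 = "floquet_minus (\<Phi> \<zeta>) (k \<zeta>) v_minus"
  have nf: "norm (?f1 x) = exp (- \<kappa> * x) * norm (y1 x)" "norm (?f2 x) = exp (\<kappa> * x) * norm (y2 x)" for x
    by (simp_all add: floquet_plus_def floquet_minus_def norm_smult_vec2 norm_exp_eq_Re \<kappa>_def y1_def y2_def)
  have cont: "continuous_on S ?f1" "continuous_on S ?f2" for S
    unfolding floquet_plus_def[abs_def] floquet_minus_def[abs_def] y1_def[symmetric] y2_def[symmetric]
    by (intro continuous_on_smult_vec continuous_intros dirac_solution_continuous[OF sol(1)]
        dirac_solution_continuous[OF sol(2)])+
  \<comment> \<open>Over one period the modulus of the multiplier is exactly compensated by the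
    exponential prefactor.\<close>
  have per: "norm (?f1 (x + a)) = norm (?f1 x)" "norm (?f2 (x + a)) = norm (?f2 x)" for x
  proof -
    have y: "y1 (x + a) = \<rho>1 *s y1 x" "y2 (x + a) = \<rho>2 *s y2 x"
      unfolding y1_def y2_def by (rule floquet_solution[OF \<Phi> q v1(2)], rule floquet_solution[OF \<Phi> q v2(2)])
    have "exp (- \<kappa> * (x + a)) * exp (\<kappa> * a) = exp (- \<kappa> * x)" "exp (\<kappa> * (x + a)) * exp (- \<kappa> * a) = exp (\<kappa> * x)"
      by (simp_all add: exp_add[symmetric] algebra_simps)
    then show "norm (?f1 (x + a)) = norm (?f1 x)" "norm (?f2 (x + a)) = norm (?f2 x)"
      unfolding nf y norm_smult_vec2 n\<rho> by (metis mult.assoc)+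
  qed
  define S1 S2 where "S1 = (SUP x\<in>{0..a}. norm (?f1 x))" and "S2 = (SUP x\<in>{0..a}. norm (?f2 x))"
  have S: "norm (?f1 t) \<le> S1" "norm (?f2 t) \<le> S2" for t
    unfolding S1_def S2_def
    by (rule norm_le_SUP_over_period[OF \<open>0 < a\<close> cont(1) per(1)], rule norm_le_SUP_over_period[OF \<open>0 < a\<close> cont(2) per(2)])
  have f0: "norm (?f1 0) = norm v_plus" "norm (?f2 0) = norm v_minus" by (simp_all add: nf y0)
  have Spos: "0 < S1" "0 < S2"
    using S[of 0] v1(1) v2(1) unfolding f0 by (metis less_le_trans zero_less_norm_iff)+
  have b1: "norm (y1 t) \<le> S1 * exp (\<kappa> * t)" for t
  proof -
    have "norm (y1 t) = norm (?f1 t) * exp (\<kappa> * t)" unfolding nf by (simp add: exp_minus field_simps)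
    then show ?thesis using S(1)[of t] by (simp add: mult_right_mono)
  qed
  have b2: "norm (y2 t) \<le> S2 * exp (- \<kappa> * t)" for t
  proof -
    have "norm (y2 t) = norm (?f2 t) * exp (- \<kappa> * t)" unfolding nf by (simp add: exp_minus field_simps)
    then show ?thesis using S(2)[of t] by (simp add: mult_right_mono)
  qed
  let ?W = "norm (wedge v_plus v_minus)"
  have "Gamma_mat (\<Phi> \<zeta> a) = ?W / (norm v_plus * norm v_minus)"
    using assms(11,12) \<open>\<rho>1 \<noteq> \<rho>2\<close> unfolding \<rho>1_def \<rho>2_def by (intro Gamma_mat_eq)
  \<comment> \<open>The periodic functions start at the eigenvectors, so the numerators of the two
    ratios cancel the denominator of \<open>Gamma_mat\<close>. What is left is the reciprocal of the
    constant in the Green kernel estimate.\<close>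
  then have G: "Gamma_mat (\<Phi> \<zeta> a) * gamma_ratio a ?f1 * gamma_ratio a ?f2 = ?W / (S1 * S2)"
    using v1(1) v2(1) by (simp add: gamma_ratio_def f0 S1_def[symmetric] S2_def[symmetric])
  let ?K = "if p = 1 then 1 else (2 * (p - 1) / (\<kappa> * p)) powr ((p - 1) / p)"
  have "?K * Lp_norm p V < ?W / (S1 * S2)"
  proof (cases "p = 1")
    case True
    then show ?thesis using assms(13) G by simp
  next
    case False
    with p have "1 < p" by simp
    let ?r = "(p - 1) / p"
    have "Lp_norm p V < ?W / (S1 * S2) * \<kappa> powr ?r * (p / (2 * (p - 1))) powr ?r"
      using assms(14)[OF \<open>1 < p\<close>] unfolding G \<kappa>_def .
    \<comment> \<open>The two powers have the same exponent and merge into the reciprocal of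
      \<open>?K\<close>.\<close>
    also have "\<dots> = ?W / (S1 * S2) * (\<kappa> * (p / (2 * (p - 1)))) powr ?r"
      using \<open>1 < p\<close> \<open>0 < \<kappa>\<close> by (simp only: mult.assoc powr_mult)
    also have "\<kappa> * (p / (2 * (p - 1))) = 1 / (2 * (p - 1) / (\<kappa> * p))" by simp
    also have "(1 / (2 * (p - 1) / (\<kappa> * p))) powr ?r = 1 / (2 * (p - 1) / (\<kappa> * p)) powr ?r"
      using \<open>1 < p\<close> \<open>0 < \<kappa>\<close> by (subst powr_divide) auto
    finally have "Lp_norm p V < ?W / (S1 * S2) / ?K" using False by simp
    moreover have "0 < ?K" using \<open>1 < p\<close> \<open>0 < \<kappa>\<close> by simp
    ultimately show ?thesis by (simp only: pos_less_divide_eq mult.commute)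
  qed
  then have "S1 * S2 * (?K * Lp_norm p V) < norm (wedge (y1 0) (y2 0))"
    unfolding y0 using Spos by (subst mult.commute) (simp only: pos_less_divide_eq mult_pos_pos)
  then show ?thesis
    by (intro no_eigenvalue_if_Green_bound[OF sol \<open>0 < \<kappa>\<close> _ _ b1 b2 p V]) (use Spos in auto)
qed

end
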